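(* Let $m, r$ and $d$ be integers such that $d \geq 1$ and $2 \leq 2r \leq m-1$. Then $$ \overline{\mathcal{A}\left(\left\lceil \tfrac{d}{2}\right\rceil,\ldots,\left\lceil \tfrac{d}{2}\right\rceil\right)} = \overline{\mathcal{G}^{ss}_{d,2r,m}} = \mathrm{POL}^{ss}_{d,2r,m}, $$ where $\lceil d/2\rceil$ appears $r$ times as an argument of $\mathcal{A}$.
   Context: All matrix polynomials have coefficients in $\mathbb{C}$. A matrix polynomial has grade $d$ if its degree is at most $d$ (the zero polynomial is allowed). $\mathrm{POL}^{p\times q}$ is the set of all $p\times q$ matrix polynomials (no grade specified), and $\mathrm{POL}^{p\times q}_{d}$ is the vector space of those of grade $d$. $\mathrm{POL}^{ss}_{d,m}$ is the vector space of $m\times m$ skew-symmetric matrix polynomials $P(\lambda)=\sum_{i=0}^d\lambda^i A_i$, $A_i\in\mathbb{C}^{m\times m}$, $A_i^T=-A_i$. The (normal) rank of a matrix polynomial is its rank over the field $\mathbb{C}(\lambda)$. $\mathrm{POL}^{ss}_{d,2r,m}$ is the set of $P\in \mathrm{POL}^{ss}_{d,m}$ with normal rank at most $2r$. $\mathrm{POL}^{ss}_{d,m}$ carries the distance $d(P,P')=\left(\sum_{i=0}^d\|A_i-A_i'\|_F^2\right)^{1/2}$, where $P=\sum_{i=0}^d \lambda^iA_i$ and $P'=\sum_{i=0}^d \lambda^iA_i'$, and $\overline{\mathcal{S}}$ denotes closure in the resulting (Euclidean) topology. The set $\mathcal{G}^{ss}_{d,2r,m}$ is $$ \mathcal{G}^{ss}_{d,2r,m}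 := \left\{ U(\lambda) V(\lambda)^T - V(\lambda) U(\lambda)^T \; : \; V(\lambda) \in \mathrm{POL}^{m\times r}_{\lceil d/2 \rceil},\; U(\lambda) \in \mathrm{POL}^{m\times r}_{\lfloor d/2 \rfloor} \right\}. $$ $\Delta_r$ is the $r\times r$ matrix with ones on the anti-diagonal and zeros elsewhere. For a matrix polynomial $L(\lambda)$, $L_{*i}$ denotes its $i$-th column; the degree of a vector polynomial is the largest power of $\lambda$ with a nonzero vector coefficient (so a vector polynomial whose degree is a nonnegative integer is nonzero). For integers $d_1,\ldots,d_r$ with $d\ge d_i\ge d/2$ for $i=1,\ldots,r$, $$ \mathcal{A}(d_1,\ldots,d_r) := \left\{ L(\lambda)\begin{bmatrix} 0 & \Delta_r\\ -\Delta_r & 0\end{bmatrix} L(\lambda)^T \; : \; \begin{array}{l} L(\lambda)\in\mathrm{POL}^{m\times 2r},\\ \deg(L_{*i})=d_i \text{ and } \deg(L_{*(2r-i+1)})=d-d_i \text{ for } i=1,\ldots,r\end{array}\right\}. $$ *)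

theory Defs
  imports
    "HOL-Analysis.Abstract_Metric_Spaces"
    "HOL-Analysis.L2_Norm"
    "HOL-Computational_Algebra.Polynomial_Factorial"
    "Jordan_Normal_Form.DL_Rank"
begin

section \<open>Matrix polynomials over the complex numbers\<close>

text \<open>A matrix polynomial is a matrix with entries in \<open>complex poly\<close>; rows and columns are
  indexed from 0.\<close>

definition POL :: "nat \<Rightarrow> nat \<Rightarrow> complex poly mat set" where
  "POL p q = carrier_mat p q"

definition POL_grade :: "nat \<Rightarrow> nat \<Rightarrow> nat \<Rightarrow> complex poly mat set" where
  "POL_grade d p q = {P \<in> POL p q. \<forall>j<p. \<forall>k<q. degree (P $$ (j, k)) \<le> d}"

definition coeff_matrix :: "nat \<Rightarrow> nat \<Rightarrow> complex poly mat \<Rightarrow> nat \<Rightarrow> complex mat" where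
  "coeff_matrix p q P i = mat p q (\<lambda>(j, k). coeff (P $$ (j, k)) i)"

definition POL_ss :: "nat \<Rightarrow> nat \<Rightarrow> complex poly mat set" where
  "POL_ss d m = {P \<in> POL_grade d m m.
     \<forall>i\<le>d. transpose_mat (coeff_matrix m m P i) = - coeff_matrix m m P i}"

text \<open>The rank over the field of rational functions, realised as the fraction field of
  \<open>complex poly\<close>.\<close>

definition normal_rank :: "complex poly mat \<Rightarrow> nat" where
  "normal_rank P = vec_space.rank (dim_row P) (map_mat to_fract P)"

text \<open>The second argument is the rank bound itself (an even number in the application).\<close>

definition POL_ss_rank :: "nat \<Rightarrow> nat \<Rightarrow> nat \<Rightarrow> complex poly mat set" where
  "POL_ss_rank d s m = {P \<in> POL_ss d m. normal_rank P \<le> s}"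


section \<open>The topology\<close>

definition frobenius_norm :: "complex mat \<Rightarrow> real" where
  "frobenius_norm A = sqrt (\<Sum>j<dim_row A. \<Sum>k<dim_col A. (cmod (A $$ (j, k)))\<^sup>2)"

definition POL_dist :: "nat \<Rightarrow> nat \<Rightarrow> complex poly mat \<Rightarrow> complex poly mat \<Rightarrow> real" where
  "POL_dist d m P Q =
     sqrt (\<Sum>i\<le>d. (frobenius_norm (coeff_matrix m m P i - coeff_matrix m m Q i))\<^sup>2)"

lemma POL_dist_L2_set:
  "POL_dist d m P Q = L2_set (\<lambda>(i, j, k). cmod (coeff (P $$ (j, k)) i - coeff (Q $$ (j, k)) i))
     ({..d} \<times> {..<m} \<times> {..<m})"
proof -
  have "(frobenius_norm (coeff_matrix m m P i - coeff_matrix m m Q i))\<^sup>2 =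
      (\<Sum>j<m. \<Sum>k<m. (cmod (coeff (P $$ (j, k)) i - coeff (Q $$ (j, k)) i))\<^sup>2)" for i
    by (auto simp: frobenius_norm_def coeff_matrix_def sum_nonneg intro!: sum.cong)
  then show ?thesis
    by (simp add: POL_dist_def L2_set_def sum.cartesian_product case_prod_unfold)
qed

text \<open>This makes \<open>Metric_space.mtopology (POL_ss d m) (POL_dist d m)\<close> the metric topology;
  without it the library constant would be unspecified.\<close>

lemma Metric_space_POL_ss: "Metric_space (POL_ss d m) (POL_dist d m)"
proof
  fix P Q :: "complex poly mat"
  show "0 \<le> POL_dist d m P Q"
    by (simp add: POL_dist_L2_set)
  show "POL_dist d m P Q = POL_dist d m Q P"
    by (simp add: POL_dist_L2_set norm_minus_commute)
next
  fix P Q :: "complex poly mat"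
  assume P: "P \<in> POL_ss d m" and Q: "Q \<in> POL_ss d m"
  show "POL_dist d m P Q = 0 \<longleftrightarrow> P = Q"
  proof
    assume "POL_dist d m P Q = 0"
    then have le: "coeff (P $$ (j, k)) i = coeff (Q $$ (j, k)) i" if "i \<le> d" "j < m" "k < m" for i j k
      using that by (auto simp: POL_dist_L2_set L2_set_eq_0_iff)
    have gt: "coeff (P $$ (j, k)) i = coeff (Q $$ (j, k)) i" if "i > d" "j < m" "k < m" for i j k
    proof -
      have "degree (P $$ (j, k)) \<le> d" "degree (Q $$ (j, k)) \<le> d"
        using that P Q by (auto simp: POL_ss_def POL_grade_def)
      with that show ?thesis
        by (simp add: coeff_eq_0)
    qed
    have "P $$ (j, k) = Q $$ (j, k)" if "j < m" "k < m" for j k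
      by (rule poly_eqI) (metis le gt that not_le)
    then show "P = Q"
      using P Q by (intro eq_matI) (auto simp: POL_ss_def POL_grade_def POL_def)
  next
    assume "P = Q"
    then show "POL_dist d m P Q = 0"
      by (simp add: POL_dist_L2_set L2_set_def case_prod_unfold)
  qed
next
  fix P Q R :: "complex poly mat"
  let ?I = "{..d} \<times> {..<m} \<times> {..<m}"
  let ?f = "\<lambda>P Q (i, j, k). cmod (coeff (P $$ (j, k)) i - coeff (Q $$ (j, k)) i)"
  have "L2_set (?f P R) ?I \<le> L2_set (\<lambda>x. ?f P Q x + ?f Q R x) ?I"
    by (rule L2_set_mono) (auto intro: norm_diff_triangle_le)
  also have "\<dots> \<le> L2_set (?f P Q) ?I + L2_set (?f Q R) ?I"
    by (rule L2_set_triangle_ineq)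
  finally show "POL_dist d m P R \<le> POL_dist d m P Q + POL_dist d m Q R"
    by (simp add: POL_dist_L2_set)
qed

definition POL_ss_closure :: "nat \<Rightarrow> nat \<Rightarrow> complex poly mat set \<Rightarrow> complex poly mat set" where
  "POL_ss_closure d m S = Metric_space.mtopology (POL_ss d m) (POL_dist d m) closure_of S"


section \<open>The sets of factorised skew-symmetric matrix polynomials\<close>

definition G_ss :: "nat \<Rightarrow> nat \<Rightarrow> nat \<Rightarrow> complex poly mat set" where
  "G_ss d r m = {U * transpose_mat V - V * transpose_mat U | U V.
     V \<in> POL_grade (nat \<lceil>real d / 2\<rceil>) m r \<and> U \<in> POL_grade (nat \<lfloor>real d / 2\<rfloor>) m r}"

definition antidiag_mat :: "nat \<Rightarrow> complex poly mat" where
  "antidiag_mat r = mat r r (\<lambda>(j, k). if j + k + 1 = r then 1 else 0)"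

definition skew_antidiag_mat :: "nat \<Rightarrow> complex poly mat" where
  "skew_antidiag_mat r =
     four_block_mat (0\<^sub>m r r) (antidiag_mat r) (- antidiag_mat r) (0\<^sub>m r r)"

text \<open>A relation rather than a function, so that the zero vector has no degree.\<close>

definition has_vec_degree :: "complex poly vec \<Rightarrow> nat \<Rightarrow> bool" where
  "has_vec_degree v n \<longleftrightarrow>
     map_vec (\<lambda>p. coeff p n) v \<noteq> 0\<^sub>v (dim_vec v) \<and>
     (\<forall>i>n. map_vec (\<lambda>p. coeff p i) v = 0\<^sub>v (dim_vec v))"

text \<open>The list \<open>ds\<close> holds the degrees of the first \<open>r = length ds\<close> columns, so with indices from 0
  the partner of column \<open>i\<close> is column \<open>2 * r - 1 - i\<close>. Meant for lists whose entries lie between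
  \<open>d / 2\<close> and \<open>d\<close>, where \<open>d - ds ! i\<close> is not truncated.\<close>

definition A_set :: "nat \<Rightarrow> nat \<Rightarrow> nat list \<Rightarrow> complex poly mat set" where
  "A_set d m ds = {L * skew_antidiag_mat (length ds) * transpose_mat L | L.
     L \<in> POL m (2 * length ds) \<and>
     (\<forall>i<length ds. has_vec_degree (col L i) (ds ! i) \<and>
        has_vec_degree (col L (2 * length ds - 1 - i)) (d - ds ! i))}"

end

theory Submission
  imports Defs "HOL-Computational_Algebra.Fundamental_Theorem_Algebra"
begin

text \<open>Let \<open>P\<close> be skew-symmetric of grade \<open>d\<close> and rank at most \<open>2 r\<close>. Skew Gaussian elimination writes a
  nonzero multiple \<open>q P\<close> as a sum of \<open>r\<close> wedge products \<open>u\<^sub>i v\<^sub>i\<^sup>T - v\<^sub>i u\<^sub>i\<^sup>T\<close>. At a root of \<open>q\<close> the sum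
  vanishes, which forces linear relations between the values of the vectors; symplectic changes of
  the family then make one vector of every pair vanish at the root, so the root can be divided out,
  and finally \<open>q = 1\<close>. The same idea at infinity (a sum of too high degree has cancelling leading
  coefficients) lowers degrees until \<open>deg u\<^sub>i + deg v\<^sub>i \<le> d\<close> for every pair. A pair of degrees \<open>(a, b)\<close>
  with \<open>a + 2 \<le> b\<close> is a limit of pairs of degrees \<open>(a + 1, b - 1)\<close>, so \<open>P\<close> is a limit of balanced sums.
  Conversely the rank condition is closed, since a nonvanishing sequence of pivots persists under
  small perturbations.\<close>

section \<open>Sums of wedge products\<close>

text \<open>This is the entry at \<open>(j, k)\<close> of \<open>U V^T - V U^T\<close>, with the
  vectors \<open>u i\<close> and \<open>v i\<close> as columns. Vectors are functions on all of
  \<open>nat\<close>, so changes of the family carry no dimension conditions.\<close>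

definition wsum :: "'i set \<Rightarrow> ('i \<Rightarrow> nat \<Rightarrow> 'a) \<Rightarrow> ('i \<Rightarrow> nat \<Rightarrow> 'a) \<Rightarrow> nat \<Rightarrow> nat \<Rightarrow> 'a::comm_ring_1"
  where "wsum I u v j k = (\<Sum>i\<in>I. u i j * v i k - v i j * u i k)"

lemma wsum_cong:
  "(\<And>i. i \<in> I \<Longrightarrow> u i = u' i) \<Longrightarrow> (\<And>i. i \<in> I \<Longrightarrow> v i = v' i) \<Longrightarrow> wsum I u v j k = wsum I u' v' j k"
  by (simp add: wsum_def)

lemma wsum_remove:
  "finite I \<Longrightarrow> i \<in> I \<Longrightarrow>
    wsum I u v j k = (u i j * v i k - v i j * u i k) + wsum (I - {i}) u v j k"
  by (simp add: wsum_def sum.remove)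

lemma wsum_fun_upd:
  assumes "finite I" "i \<in> I"
  shows "wsum I (u(i := x)) (v(i := y)) j k = (x j * y k - y j * x k) + wsum (I - {i}) u v j k"
proof -
  have "wsum (I - {i}) (u(i := x)) (v(i := y)) j k = wsum (I - {i}) u v j k"
    by (rule wsum_cong) auto
  then show ?thesis
    using assms by (simp add: wsum_remove)
qed

text \<open>One pair is rotated by a symplectic map of the plane. Arguments that single out a vector
  may thus assume that it is some \<open>u j\<close>.\<close>

lemma wsum_swap:
  assumes "finite I" "i \<in> I"
  shows "wsum I (u(i := v i)) (v(i := \<lambda>l. - u i l)) = wsum I u v"
  unfolding fun_eq_iff wsum_fun_upd[OF assms] wsum_remove[OF assms, of u v] by simp

lemma wsum_skew: "wsum I u v k j = - wsum I u v j k"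
  by (simp add: wsum_def sum_negf[symmetric] algebra_simps)

text \<open>For \<open>i\<close> other than \<open>j\<close>, correcting the pair by multiples of
  \<open>v j\<close> subtracts the wedge of \<open>p i u i + q i v i\<close> with
  \<open>v j\<close>; adding all these combinations to \<open>u j\<close> restores exactly that. The
  term \<open>q j v j\<close> is harmless because its wedge with \<open>v j\<close> is zero, while
  \<open>p j\<close> must vanish so that \<open>u j\<close> keeps coefficient one.\<close>

lemma wsum_symplectic_step:
  fixes p q :: "'i \<Rightarrow> 'a::comm_ring_1" and u v :: "'i \<Rightarrow> nat \<Rightarrow> 'a"
  assumes fin: "finite I" and j: "j \<in> I" and pj: "p j = 0"
  defines "u' \<equiv> \<lambda>i. if i = j then \<lambda>k. u j k + (\<Sum>l\<in>I. p l * u l k + q l * v l k)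
                     else (\<lambda>k. u i k + q i * v j k)"
    and "v' \<equiv> \<lambda>i. if i = j then v j else (\<lambda>k. v i k - p i * v j k)"
  shows "wsum I u' v' = wsum I u v"
proof (intro ext)
  fix k l
  let ?J = "I - {j}"
  have S: "(\<Sum>i\<in>I. p i * u i k + q i * v i k) =
      q j * v j k + (\<Sum>i\<in>?J. p i * u i k + q i * v i k)" for k
    using fin j pj by (simp add: sum.remove[of I j])
  have "wsum ?J u' v' k l = (\<Sum>i\<in>?J. (u i k + q i * v j k) * (v i l - p i * v j l)
      - (v i k - p i * v j k) * (u i l + q i * v j l))"
    unfolding wsum_def by (rule sum.cong) (auto simp: u'_def v'_def)
  also have "\<dots> = (\<Sum>i\<in>?J. (u i k * v i l - v i k * u i l) -
      ((p i * u i k + q i * v i k) * v j l - v j k * (p i * u i l + q i * v i l)))"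
    by (rule sum.cong) (auto simp: algebra_simps)
  also have "\<dots> = wsum ?J u v k l - ((\<Sum>i\<in>?J. p i * u i k + q i * v i k) * v j l
      - v j k * (\<Sum>i\<in>?J. p i * u i l + q i * v i l))"
    unfolding wsum_def sum_distrib_left sum_distrib_right sum_subtractf ..
  finally have A: "wsum ?J u' v' k l = wsum ?J u v k l - ((\<Sum>i\<in>?J. p i * u i k + q i * v i k) * v j l
      - v j k * (\<Sum>i\<in>?J. p i * u i l + q i * v i l))" .
  show "wsum I u' v' k l = wsum I u v k l"
    unfolding wsum_remove[OF fin j] A
    by (simp add: u'_def v'_def S algebra_simps)
qed

text \<open>A single vanishing column of the matrix is already a linear relation between the
  vectors, with their \<open>k\<close>-th coordinates as coefficients.\<close>

lemma wsum_eq_0_imp_relation: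
  assumes "\<And>j. wsum I x y j k = 0"
  shows "(\<Sum>i\<in>I. y i k * x i l + (- x i k) * y i l) = 0"
  using assms[of l] by (simp add: wsum_def mult.commute)

section \<open>Dividing out scalar factors\<close>

text \<open>If \<open>v j\<close> has a nonzero \<open>k\<close>-th coordinate at \<open>c\<close>,
  column \<open>k\<close> gives a relation between the values at \<open>c\<close> in which that of
  \<open>u j\<close> has a nonzero coefficient. A symplectic step then makes \<open>u j\<close>
  vanish at \<open>c\<close>, so the remaining pairs again have zero sum at \<open>c\<close> and
  induction applies to them.\<close>

lemma wsum_vanish_at_point:
  fixes u v :: "'i \<Rightarrow> nat \<Rightarrow> 'a::field poly"
  assumes "finite I" and "\<And>j k. poly (wsum I u v j k) c = 0"
  shows "\<exists>u' v'. wsum I u' v' = wsum I u v \<and>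
    (\<forall>i\<in>I. (\<forall>j. poly (u' i j) c = 0) \<or> (\<forall>j. poly (v' i j) c = 0))"
  using assms
proof (induction "card I" arbitrary: I u v)
  case 0
  then show ?case by auto
next
  case (Suc n)
  show ?case
  proof (cases "\<forall>i\<in>I. \<forall>j. poly (v i j) c = 0")
    case True
    then show ?thesis by blast
  next
    case False
    then obtain j k where j: "j \<in> I" and k: "poly (v j k) c \<noteq> 0" by blast
    define x y where "x = (\<lambda>i l. poly (u i l) c)" and "y = (\<lambda>i l. poly (v i l) c)"
    \<comment> \<open>The relation is divided by the coefficient \<open>y j k\<close> of
      \<open>x j\<close>; since \<open>u j\<close> itself supplies that term, \<open>p j\<close> is
      zero. The coefficients are constant polynomials because only values at \<open>c\<close>
      matter.\<close>
    define p q where "p = (\<lambda>i. if i = j then 0 else [:y i k / y j k:])"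
      and "q = (\<lambda>i. [:- x i k / y j k:])"
    define u' v' where "u' = (\<lambda>i. if i = j then \<lambda>k. u j k + (\<Sum>l\<in>I. p l * u l k + q l * v l k)
                     else (\<lambda>k. u i k + q i * v j k))"
      and "v' = (\<lambda>i. if i = j then v j else (\<lambda>k. v i k - p i * v j k))"
    have eq: "wsum I u' v' = wsum I u v"
      unfolding u'_def v'_def by (rule wsum_symplectic_step) (use Suc.prems j in \<open>auto simp: p_def\<close>)
    have "wsum I x y a b = poly (wsum I u v a b) c" for a b
      by (simp add: wsum_def x_def y_def poly_sum)
    then have rel: "(\<Sum>i\<in>I. y i k * x i l + (- x i k) * y i l) = 0" for l
      by (intro wsum_eq_0_imp_relation) (simp add: Suc.prems)
    have yjk: "y j k \<noteq> 0" using k by (simp add: y_def)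
    have u'j: "poly (u' j l) c = 0" for l
    proof -
      have "y j k * poly (u' j l) c = y j k * x j l +
          y j k * (\<Sum>i\<in>I. poly (p i) c * x i l + (- x i k / y j k) * y i l)"
        by (simp add: u'_def poly_sum x_def y_def q_def algebra_simps)
      also have "\<dots> = y j k * x j l +
          (\<Sum>i\<in>I. y j k * (poly (p i) c * x i l + (- x i k / y j k) * y i l))"
        by (simp add: sum_distrib_left)
      also have "\<dots> = y j k * x j l + (- x j k) * y j l
         + (\<Sum>i\<in>I - {j}. y j k * (poly (p i) c * x i l + (- x i k / y j k) * y i l))"
        using Suc.prems j yjk by (simp add: sum.remove[of I j] p_def)
      also have "(\<Sum>i\<in>I - {j}. y j k * (poly (p i) c * x i l + (- x i k / y j k) * y i l))
          = (\<Sum>i\<in>I - {j}. y i k * x i l + (- x i k) * y i l)"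
        by (rule sum.cong) (use yjk in \<open>auto simp: p_def field_simps\<close>)
      also have "y j k * x j l + (- x j k) * y j l + \<dots> = 0"
        using rel[of l] Suc.prems j by (simp add: sum.remove[of I j])
      finally show ?thesis using yjk by simp
    qed
    have "poly (wsum (I - {j}) u' v' a b) c = 0" for a b
    proof -
      have "poly (wsum I u' v' a b) c = 0" unfolding eq by (rule Suc.prems)
      then show ?thesis
        using u'j by (simp add: wsum_remove[OF Suc.prems(1) j])
    qed
    moreover have "n = card (I - {j})" using Suc.hyps(2) j by simp
    ultimately obtain u'' v'' where uv'': "wsum (I - {j}) u'' v'' = wsum (I - {j}) u' v'"
      "\<forall>i\<in>I - {j}. (\<forall>l. poly (u'' i l) c = 0) \<or> (\<forall>l. poly (v'' i l) c = 0)"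
      using Suc.hyps(1)[of "I - {j}" u' v'] Suc.prems(1) by blast
    have "wsum I (u''(j := u' j)) (v''(j := v' j)) = wsum I u v"
      unfolding eq[symmetric] using Suc.prems(1) j
      by (intro ext) (simp add: wsum_fun_upd uv''(1) wsum_remove[of I j])
    moreover have "\<forall>i\<in>I. (\<forall>l. poly ((u''(j := u' j)) i l) c = 0) \<or> (\<forall>l. poly ((v''(j := v' j)) i l) c = 0)"
      using u'j uv''(2) by auto
    ultimately show ?thesis by blast
  qed
qed

lemma wsum_cancel_linear_factor:
  fixes u v :: "'i \<Rightarrow> nat \<Rightarrow> 'a::field poly"
  assumes "finite I" and eq: "\<And>j k. [:- c, 1:] * P j k = wsum I u v j k"
  shows "\<exists>u' v'. \<forall>j k. P j k = wsum I u' v' j k"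
proof -
  have "poly (wsum I u v j k) c = 0" for j k
    by (simp flip: eq)
  then obtain u' v' where w: "wsum I u' v' = wsum I u v"
    and z: "\<forall>i\<in>I. (\<forall>j. poly (u' i j) c = 0) \<or> (\<forall>j. poly (v' i j) c = 0)"
    using wsum_vanish_at_point[OF \<open>finite I\<close>] by blast
  let ?l = "[:- c, 1:]"
  \<comment> \<open>Exactly one vector of each pair is divided by the linear factor:
    \<open>u' i\<close> whenever it vanishes at \<open>c\<close>, even if \<open>v' i\<close> does
    too, and \<open>v' i\<close> otherwise.\<close>
  define U where "U = (\<lambda>i j. if \<forall>j. poly (u' i j) c = 0 then u' i j div ?l else u' i j)"
  define V where "V = (\<lambda>i j. if \<forall>j. poly (u' i j) c = 0 then v' i j else v' i j div ?l)"
  have d: "p div ?l * ?l = p" if "poly p c = 0" for p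
    using that unfolding poly_eq_0_iff_dvd by (rule dvd_div_mult_self)
  have "?l * (U i j * V i k - V i j * U i k) = u' i j * v' i k - v' i j * u' i k" if "i \<in> I" for i j k
  proof (cases "\<forall>j. poly (u' i j) c = 0")
    case True
    then have "u' i j = ?l * U i j" "V i j = v' i j" for j
      using d[of "u' i j"] unfolding U_def V_def if_P[OF True] by (simp_all only: mult.commute[of ?l])
    then show ?thesis by (simp only: algebra_simps)
  next
    case False
    then have "poly (v' i j) c = 0" for j
      using z that by blast
    with False have "v' i j = ?l * V i j" "U i j = u' i j" for j
      using d[of "v' i j"] unfolding U_def V_def if_not_P[OF False]
      by (simp_all add: mult.commute[of ?l] del: mult_pCons_right mult_pCons_left)
    then show ?thesis by (simp only: algebra_simps)
  qed
  then have "?l * wsum I U V j k = wsum I u' v' j k" for j k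
    by (simp add: wsum_def sum_distrib_left del: mult_pCons_left)
  then have "?l * wsum I U V j k = ?l * P j k" for j k
    by (simp add: w eq del: mult_pCons_left)
  then have "P j k = wsum I U V j k" for j k
    by (metis mult_cancel_left pCons_eq_0_iff zero_neq_one)
  then show ?thesis by blast
qed

text \<open>Over the complex numbers a nonconstant \<open>q\<close> has a root, so linear factors
  are cancelled one at a time; a remaining nonzero constant is absorbed into
  \<open>u\<close>.\<close>

lemma wsum_cancel_factor:
  fixes u v :: "'i \<Rightarrow> nat \<Rightarrow> complex poly"
  assumes "finite I" "q \<noteq> 0" and "\<And>j k. q * P j k = wsum I u v j k"
  shows "\<exists>u' v'. \<forall>j k. P j k = wsum I u' v' j k"
  using assms(2,3)
proof (induction "degree q" arbitrary: q u v)
  case 0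
  then obtain c where c: "q = [:c:]" "c \<noteq> 0"
    by (metis degree_eq_zeroE pCons_0_0)
  have "P j k = wsum I (\<lambda>i j. [:inverse c:] * u i j) v j k" for j k
  proof -
    have "P j k = [:inverse c:] * (q * P j k)"
      using c by simp
    also have "\<dots> = (\<Sum>i\<in>I. [:inverse c:] * (u i j * v i k - v i j * u i k))"
      unfolding 0 wsum_def sum_distrib_left ..
    also have "\<dots> = wsum I (\<lambda>i j. [:inverse c:] * u i j) v j k"
      unfolding wsum_def by (rule sum.cong) (simp_all only: algebra_simps)
    finally show ?thesis .
  qed
  then show ?case by blast
next
  case (Suc n)
  then have "\<not> constant (poly q)"
    by (simp add: constant_degree)
  then obtain c where "poly q c = 0"
    using fundamental_theorem_of_algebra by blast
  then obtain s where s: "q = [:- c, 1:] * s"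
    by (metis poly_eq_0_iff_dvd dvd_def)
  with Suc.prems(1) have s0: "s \<noteq> 0" by auto
  have "degree q = Suc (degree s)"
    unfolding s using s0 by (subst degree_mult_eq) auto
  with Suc.hyps(2) have deg: "n = degree s" by simp
  have "[:- c, 1:] * (s * P j k) = wsum I u v j k" for j k
    using Suc.prems(2)[of j k] by (simp only: s mult.assoc)
  from wsum_cancel_linear_factor[OF \<open>finite I\<close> this] obtain u' v' where
    "\<forall>j k. s * P j k = wsum I u' v' j k" by blast
  then show ?case
    using Suc.hyps(1)[OF deg s0] by blast
qed

section \<open>Degree reduction\<close>

lemma coeff_mult_at_bounds:
  assumes "degree p \<le> a" "degree q \<le> b"
  shows "coeff (p * q) (a + b) = coeff p a * coeff q b"
proof (cases "degree p = a \<and> degree q = b")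
  case True
  then show ?thesis by (auto simp: coeff_mult_degree_sum)
next
  case False
  then have "degree p + degree q < a + b" and "degree p < a \<or> degree q < b"
    using assms by auto
  then show ?thesis
    by (auto simp: coeff_eq_0 intro!: coeff_eq_0 le_less_trans[OF degree_mult_le])
qed

lemma degree_le_diff_1:
  assumes "degree p \<le> n" "coeff p n = 0"
  shows "degree p \<le> n - 1"
proof (rule degree_le, intro allI impI)
  fix i assume "n - 1 < i"
  then have "i = n \<or> n < i" by linarith
  then show "coeff p i = 0"
    using assms by (auto intro: coeff_eq_0)
qed

text \<open>Pairs whose bounds add up to less than \<open>D\<close> do not reach this coefficient.
  As \<open>a\<close> and \<open>b\<close> are only bounds, the coefficients on the right may be
  zero.\<close>

lemma wsum_top_coeff:
  fixes u v :: "'i \<Rightarrow> nat \<Rightarrow> 'a::comm_ring_1 poly"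
  assumes fin: "finite I"
    and deg: "\<And>i j. i \<in> I \<Longrightarrow> degree (u i j) \<le> a i" "\<And>i j. i \<in> I \<Longrightarrow> degree (v i j) \<le> b i"
    and le: "\<And>i. i \<in> I \<Longrightarrow> a i + b i \<le> D"
  shows "coeff (wsum I u v j k) D =
    wsum {i\<in>I. a i + b i = D} (\<lambda>i j. coeff (u i j) (a i)) (\<lambda>i j. coeff (v i j) (b i)) j k"
proof -
  have "coeff (u i j * v i k) D = (if a i + b i = D then coeff (u i j) (a i) * coeff (v i k) (b i) else 0)"
    if "i \<in> I" for i j k
  proof (cases "a i + b i = D")
    case True
    then show ?thesis using coeff_mult_at_bounds[OF deg(1)[OF that] deg(2)[OF that]] by auto
  next
    case False
    then have "a i + b i < D" using le[OF that] by simp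
    moreover have "degree (u i j * v i k) \<le> a i + b i"
      using degree_mult_le[of "u i j" "v i k"] deg[OF that, of j] deg[OF that, of k] by linarith
    ultimately show ?thesis using False by (simp add: coeff_eq_0)
  qed
  then have "coeff (wsum I u v j k) D = (\<Sum>i\<in>I. if a i + b i = D then
      coeff (u i j) (a i) * coeff (v i k) (b i) - coeff (v i j) (b i) * coeff (u i k) (a i) else 0)"
    unfolding wsum_def coeff_sum by (intro sum.cong) (auto simp: mult.commute)
  also have "\<dots> = wsum {i\<in>I. a i + b i = D} (\<lambda>i j. coeff (u i j) (a i)) (\<lambda>i j. coeff (v i j) (b i)) j k"
    unfolding wsum_def using fin by (simp add: sum.inter_filter)
  finally show ?thesis .
qed

text \<open>A column through a nonzero coordinate of some \<open>y i\<close> gives the relation; if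
  the chosen \<open>y i\<close> is zero, that vector alone is one.\<close>

lemma wsum_eq_0_imp_nontrivial_relation:
  fixes x y :: "'i \<Rightarrow> nat \<Rightarrow> 'a::comm_ring_1"
  assumes fin: "finite I" and "I \<noteq> {}" and w: "\<And>j k. wsum I x y j k = 0"
  shows "\<exists>\<alpha> \<beta>. (\<exists>i\<in>I. \<alpha> i \<noteq> 0 \<or> \<beta> i \<noteq> 0) \<and> (\<forall>l. (\<Sum>i\<in>I. \<alpha> i * x i l + \<beta> i * y i l) = 0)"
proof -
  obtain i where i: "i \<in> I" using \<open>I \<noteq> {}\<close> by blast
  show ?thesis
  proof (cases "\<forall>k. y i k = 0")
    case True
    have "(\<Sum>h\<in>I. 0 * x h l + (if h = i then 1 else 0) * y h l) = 0" for l
      using True by (intro sum.neutral) auto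
    with i show ?thesis
      by (intro exI[of _ "\<lambda>_. 0"] exI[of _ "\<lambda>h. if h = i then 1 else 0"]) auto
  next
    case False
    then obtain k where "y i k \<noteq> 0" by blast
    then show ?thesis
      using i wsum_eq_0_imp_relation[OF w]
      by (intro exI[of _ "\<lambda>i. y i k"] exI[of _ "\<lambda>i. - x i k"]) blast
  qed
qed

text \<open>All pairs involved have the same degree sum \<open>D\<close>; this is what keeps the other degree bounds
  intact when the symplectic step cancels the leading coefficient of \<open>u j\<close>.\<close>

lemma wsum_decrease_degree_left:
  fixes u v :: "'i \<Rightarrow> nat \<Rightarrow> 'a::field poly"
  assumes fin: "finite I"
    and deg: "\<And>i l. i \<in> I \<Longrightarrow> degree (u i l) \<le> a i" "\<And>i l. i \<in> I \<Longrightarrow> degree (v i l) \<le> b i"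
    and K: "K \<subseteq> I" "\<And>i. i \<in> K \<Longrightarrow> a i + b i = D" and D: "D > 0"
    and j: "j \<in> K" and \<alpha>j: "\<alpha> j \<noteq> 0"
    and rel: "\<And>l. (\<Sum>i\<in>K. \<alpha> i * coeff (u i l) (a i) + \<beta> i * coeff (v i l) (b i)) = 0"
    and max: "\<And>i. i \<in> K \<Longrightarrow> \<alpha> i \<noteq> 0 \<Longrightarrow> a i \<le> a j" "\<And>i. i \<in> K \<Longrightarrow> \<beta> i \<noteq> 0 \<Longrightarrow> b i \<le> a j"
  shows "\<exists>u' v' a' b'. wsum I u' v' = wsum I u v \<and>
    (\<forall>i\<in>I. \<forall>l. degree (u' i l) \<le> a' i \<and> degree (v' i l) \<le> b' i) \<and>
    (\<Sum>i\<in>I. a' i + b' i) < (\<Sum>i\<in>I. a i + b i)"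
proof -
  \<comment> \<open>The monomials lift every vector of the relation to degree \<open>a j\<close>,
    the largest bound occurring in it, so that the coefficients at the bounds all meet at that power
    and cancel.\<close>
  define p where "p = (\<lambda>i. if i \<in> K \<and> i \<noteq> j then monom (\<alpha> i / \<alpha> j) (a j - a i) else 0)"
  define q where "q = (\<lambda>i. if i \<in> K then monom (\<beta> i / \<alpha> j) (a j - b i) else 0)"
  define u' v' where "u' = (\<lambda>i. if i = j then \<lambda>k. u j k + (\<Sum>l\<in>I. p l * u l k + q l * v l k)
                   else (\<lambda>k. u i k + q i * v j k))"
    and "v' = (\<lambda>i. if i = j then v j else (\<lambda>k. v i k - p i * v j k))"
  have jI: "j \<in> I" using K j by blast
  have eq: "wsum I u' v' = wsum I u v"
    unfolding u'_def v'_def by (rule wsum_symplectic_step) (use fin jI in \<open>auto simp: p_def\<close>)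
  have pu: "degree (p i * f) \<le> a j - a i + n" if "degree f \<le> n" for i f n
    using order.trans[OF degree_mult_le[of "p i" f] add_mono[OF _ that, of _ "a j - a i"]]
    by (auto simp: p_def degree_monom_le)
  have qv: "degree (q i * f) \<le> a j - b i + n" if "degree f \<le> n" for i f n
    using order.trans[OF degree_mult_le[of "q i" f] add_mono[OF _ that, of _ "a j - b i"]]
    by (auto simp: q_def degree_monom_le)
  have p0: "p i = 0" if "\<not> (i \<in> K \<and> \<alpha> i \<noteq> 0)" for i using that by (auto simp: p_def)
  have q0: "q i = 0" if "\<not> (i \<in> K \<and> \<beta> i \<noteq> 0)" for i using that by (auto simp: q_def)
  \<comment> \<open>Equal sums give \<open>a j - a i = b i - b j\<close>, so
    \<open>p i * v j\<close> respects the bound \<open>b i\<close>; likewise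
    \<open>q i * v j\<close> respects \<open>a i\<close>.\<close>
  have Kab: "i \<in> K \<Longrightarrow> a i + b i = a j + b j" for i using K j by simp
  have dpu: "degree (p i * u i l) \<le> a j" if "i \<in> I" for i l
    using pu[OF deg(1)[OF that, of l], of i] p0[of i] max(1)[of i]
    by (cases "i \<in> K \<and> \<alpha> i \<noteq> 0") auto
  have dqv: "degree (q i * v i l) \<le> a j" if "i \<in> I" for i l
    using qv[OF deg(2)[OF that, of l], of i] q0[of i] max(2)[of i]
    by (cases "i \<in> K \<and> \<beta> i \<noteq> 0") auto
  have dpv: "degree (p i * v j l) \<le> b i" for i l
    using pu[OF deg(2)[OF jI, of l], of i] p0[of i] max(1)[of i] Kab[of i]
    by (cases "i \<in> K \<and> \<alpha> i \<noteq> 0") auto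
  have dqvj: "degree (q i * v j l) \<le> a i" for i l
    using qv[OF deg(2)[OF jI, of l], of i] q0[of i] max(2)[of i] Kab[of i]
    by (cases "i \<in> K \<and> \<beta> i \<noteq> 0") auto
  have degu': "degree (u' i l) \<le> a i" if "i \<in> I" for i l
    using that deg dpu dqv dqvj fin by (auto simp: u'_def intro!: degree_add_le degree_sum_le)
  have degv': "degree (v' i l) \<le> b i" if "i \<in> I" for i l
    using that deg dpv by (auto simp: v'_def intro!: degree_diff_le)
  have cp: "coeff (p i * u i l) (a j) = (if i \<in> K \<and> i \<noteq> j then \<alpha> i / \<alpha> j * coeff (u i l) (a i) else 0)" for i l
    using max(1)[of i] by (cases "\<alpha> i = 0") (auto simp: p_def coeff_monom_mult)
  have cq: "coeff (q i * v i l) (a j) = (if i \<in> K then \<beta> i / \<alpha> j * coeff (v i l) (b i) else 0)" for i l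
    using max(2)[of i] by (cases "\<beta> i = 0") (auto simp: q_def coeff_monom_mult)
  have top: "coeff (u' j l) (a j) = 0" for l
  proof -
    have "coeff (u' j l) (a j) = coeff (u j l) (a j) +
        (\<Sum>i\<in>I. if i \<in> K then (if i = j then 0 else \<alpha> i / \<alpha> j * coeff (u i l) (a i))
          + \<beta> i / \<alpha> j * coeff (v i l) (b i) else 0)"
    proof -
      have "(\<Sum>i\<in>I. coeff (p i * u i l + q i * v i l) (a j)) =
        (\<Sum>i\<in>I. if i \<in> K then (if i = j then 0 else \<alpha> i / \<alpha> j * coeff (u i l) (a i))
          + \<beta> i / \<alpha> j * coeff (v i l) (b i) else 0)"
        by (rule sum.cong) (simp_all add: cp cq)
      then show ?thesis by (simp add: u'_def coeff_sum)
    qed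
    also have "\<dots> = coeff (u j l) (a j) +
        (\<Sum>i\<in>K. (if i = j then 0 else \<alpha> i / \<alpha> j * coeff (u i l) (a i)) + \<beta> i / \<alpha> j * coeff (v i l) (b i))"
      using K(1) fin by (simp add: sum.inter_restrict[symmetric] Int_absorb1)
    also have "\<dots> = (\<Sum>i\<in>K. (\<alpha> i * coeff (u i l) (a i) + \<beta> i * coeff (v i l) (b i)) / \<alpha> j)"
      using finite_subset[OF K(1) fin] j \<alpha>j
      by (simp add: sum.remove[of K j] add_divide_distrib)
    also have "\<dots> = 0"
      by (simp only: sum_divide_distrib[symmetric] rel) simp
    finally show ?thesis .
  qed
  show ?thesis
  proof (cases "a j = 0")
    case False
    have "\<forall>i\<in>I. \<forall>l. degree (u' i l) \<le> (a(j := a j - 1)) i \<and> degree (v' i l) \<le> b i"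
      using degu' degv' degree_le_diff_1[OF _ top] jI by auto
    moreover have "(\<Sum>i\<in>I. (a(j := a j - 1)) i + b i) < (\<Sum>i\<in>I. a i + b i)"
      using fin jI False by (intro sum_strict_mono_ex1) auto
    ultimately show ?thesis using eq by blast
  next
    \<comment> \<open>The bound of \<open>u' j\<close> cannot drop below zero, but now
      \<open>u' j\<close> is zero and its pair contributes nothing. Its partner is replaced by zero,
      which lowers the bound \<open>b j = D > 0\<close>.\<close>
    case True
    have z: "u' j l = 0" for l
      using top[of l] degu'[OF jI, of l] True by (auto elim!: degree_eq_zeroE)
    have "wsum I u' (v'(j := \<lambda>_. 0)) = wsum I u' v'"
      unfolding fun_eq_iff wsum_def
      by (intro allI sum.cong) (auto simp: z)
    moreover have "\<forall>i\<in>I. \<forall>l. degree (u' i l) \<le> a i \<and> degree ((v'(j := \<lambda>_. 0)) i l) \<le> (b(j := 0)) i"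
      using degu' degv' by auto
    moreover have "b j > 0" using K(2)[OF j] D True by simp
    then have "(\<Sum>i\<in>I. a i + (b(j := 0)) i) < (\<Sum>i\<in>I. a i + b i)"
      using fin jI by (intro sum_strict_mono_ex1) auto
    ultimately show ?thesis
      unfolding eq[symmetric]
      by (intro exI[of _ u'] exI[of _ "v'(j := \<lambda>_. 0)"] exI[of _ a] exI[of _ "b(j := 0)"] conjI)
  qed
qed

text \<open>The vector to be reduced is one of largest bound among those with a nonzero coefficient
  in the relation. If it is some \<open>v j\<close>, its pair is rotated first.\<close>

lemma wsum_decrease_degree:
  fixes u v :: "'i \<Rightarrow> nat \<Rightarrow> 'a::field poly"
  assumes fin: "finite I"
    and deg: "\<And>i l. i \<in> I \<Longrightarrow> degree (u i l) \<le> a i" "\<And>i l. i \<in> I \<Longrightarrow> degree (v i l) \<le> b i"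
    and K: "K \<subseteq> I" "\<And>i. i \<in> K \<Longrightarrow> a i + b i = D" and D: "D > 0"
    and nz: "\<exists>i\<in>K. \<alpha> i \<noteq> 0 \<or> \<beta> i \<noteq> 0"
    and rel: "\<And>l. (\<Sum>i\<in>K. \<alpha> i * coeff (u i l) (a i) + \<beta> i * coeff (v i l) (b i)) = 0"
  shows "\<exists>u' v' a' b'. wsum I u' v' = wsum I u v \<and>
    (\<forall>i\<in>I. \<forall>l. degree (u' i l) \<le> a' i \<and> degree (v' i l) \<le> b' i) \<and>
    (\<Sum>i\<in>I. a' i + b' i) < (\<Sum>i\<in>I. a i + b i)"
proof -
  define S where "S = a ` {i\<in>K. \<alpha> i \<noteq> 0} \<union> b ` {i\<in>K. \<beta> i \<noteq> 0}"
  have "finite S" using finite_subset[OF K(1) fin] by (simp add: S_def)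
  moreover have "S \<noteq> {}" using nz by (auto simp: S_def)
  ultimately have Max: "Max S \<in> S" "\<And>x. x \<in> S \<Longrightarrow> x \<le> Max S" by auto
  from Max(1) consider j where "j \<in> K" "\<alpha> j \<noteq> 0" "Max S = a j" | j where "j \<in> K" "\<beta> j \<noteq> 0" "Max S = b j"
    unfolding S_def by blast
  then show ?thesis
  proof cases
    case 1
    show ?thesis
      by (rule wsum_decrease_degree_left[OF fin deg K D 1(1,2) rel])
        (use Max(2) in \<open>auto simp: S_def 1(3)[symmetric]\<close>)
  next
    case 2
    have jI: "j \<in> I" using K 2 by blast
    let ?u = "u(j := v j)" and ?v = "v(j := \<lambda>l. - u j l)" and ?a = "a(j := b j)" and ?b = "b(j := a j)"
    \<comment> \<open>The relation follows the rotation: the old \<open>u j\<close> is minus the new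
      second vector, whence the sign.\<close>
    let ?\<alpha> = "\<alpha>(j := \<beta> j)" and ?\<beta> = "\<beta>(j := - \<alpha> j)"
    have rel': "(\<Sum>i\<in>K. ?\<alpha> i * coeff (?u i l) (?a i) + ?\<beta> i * coeff (?v i l) (?b i)) = 0" for l
      unfolding rel[of l, symmetric] by (rule sum.cong) auto
    have "\<exists>u' v' a' b'. wsum I u' v' = wsum I ?u ?v \<and>
      (\<forall>i\<in>I. \<forall>l. degree (u' i l) \<le> a' i \<and> degree (v' i l) \<le> b' i) \<and>
      (\<Sum>i\<in>I. a' i + b' i) < (\<Sum>i\<in>I. ?a i + ?b i)"
    proof (rule wsum_decrease_degree_left[OF fin _ _ K(1) _ D 2(1) _ rel'])
      fix i assume i: "i \<in> K"
      show "?a i + ?b i = D" using K(2)[OF i] by auto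
      have "a i \<le> b j" if "\<alpha> i \<noteq> 0" using that i Max(2)[of "a i"] 2(3) by (auto simp: S_def)
      moreover have "b i \<le> b j" if "\<beta> i \<noteq> 0" using that i Max(2)[of "b i"] 2(3) by (auto simp: S_def)
      ultimately show "?\<alpha> i \<noteq> 0 \<Longrightarrow> ?a i \<le> ?a j" "?\<beta> i \<noteq> 0 \<Longrightarrow> ?b i \<le> ?a j"
        by (auto split: if_splits)
    qed (use deg 2 in auto)
    moreover have "(\<Sum>i\<in>I. ?a i + ?b i) = (\<Sum>i\<in>I. a i + b i)"
      by (rule sum.cong) auto
    ultimately show ?thesis by (simp only: wsum_swap[OF fin jI])
  qed
qed

text \<open>Induction on the total of the bounds. If the largest pair sum \<open>D\<close> exceeds
  \<open>d\<close>, the coefficient of the sum at \<open>D\<close> is zero, so the coefficients at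
  the bounds of the pairs attaining \<open>D\<close> are dependent and some bound can be
  lowered.\<close>

lemma wsum_reduce_degrees:
  fixes u v :: "'i \<Rightarrow> nat \<Rightarrow> 'a::field poly"
  assumes fin: "finite I"
    and "\<And>i l. i \<in> I \<Longrightarrow> degree (u i l) \<le> a i" "\<And>i l. i \<in> I \<Longrightarrow> degree (v i l) \<le> b i"
    and "\<And>j k. degree (wsum I u v j k) \<le> d"
  shows "\<exists>u' v' a'. wsum I u' v' = wsum I u v \<and>
    (\<forall>i\<in>I. a' i \<le> d \<and> (\<forall>l. degree (u' i l) \<le> a' i \<and> degree (v' i l) \<le> d - a' i))"
  using assms(2-)
proof (induction "\<Sum>i\<in>I. a i + b i" arbitrary: u v a b rule: less_induct)
  case less
  show ?case
  proof (cases "\<forall>i\<in>I. a i + b i \<le> d")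
    case True
    then have "\<forall>i\<in>I. a i \<le> d \<and> (\<forall>l. degree (u i l) \<le> a i \<and> degree (v i l) \<le> d - a i)"
      using less.prems(1,2) by (fastforce intro: order.trans)
    then show ?thesis by blast
  next
    case False
    define D where "D = Max ((\<lambda>i. a i + b i) ` I)"
    define K where "K = {i\<in>I. a i + b i = D}"
    have "I \<noteq> {}" using False by blast
    then have "D \<in> (\<lambda>i. a i + b i) ` I" unfolding D_def using fin by (intro Max_in) auto
    then have "K \<noteq> {}" by (auto simp: K_def)
    have le: "a i + b i \<le> D" if "i \<in> I" for i
      unfolding D_def using fin that by (intro Max_ge) auto
    have "D > d" using False le by (meson less_le_trans not_le)
    have "wsum K (\<lambda>i j. coeff (u i j) (a i)) (\<lambda>i j. coeff (v i j) (b i)) j k = 0" for j k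
      using wsum_top_coeff[where u = u and v = v and a = a and b = b and j = j and k = k, OF fin less.prems(1,2) le] less.prems(3)[of j k] \<open>D > d\<close>
      by (simp add: K_def coeff_eq_0)
    from wsum_eq_0_imp_nontrivial_relation[OF _ \<open>K \<noteq> {}\<close> this] fin
    obtain \<alpha> \<beta> where rel: "\<exists>i\<in>K. \<alpha> i \<noteq> 0 \<or> \<beta> i \<noteq> 0"
      "\<And>l. (\<Sum>i\<in>K. \<alpha> i * coeff (u i l) (a i) + \<beta> i * coeff (v i l) (b i)) = 0"
      by (auto simp: K_def)
    have "\<exists>u' v' a' b'. wsum I u' v' = wsum I u v \<and>
      (\<forall>i\<in>I. \<forall>l. degree (u' i l) \<le> a' i \<and> degree (v' i l) \<le> b' i) \<and>
      (\<Sum>i\<in>I. a' i + b' i) < (\<Sum>i\<in>I. a i + b i)"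
      by (rule wsum_decrease_degree[of I u a v b K D \<alpha> \<beta>])
        (use fin less.prems(1,2) rel \<open>D > d\<close> in \<open>simp_all add: K_def\<close>)
    then obtain u' v' a' b' where *: "wsum I u' v' = wsum I u v"
      "\<forall>i\<in>I. \<forall>l. degree (u' i l) \<le> a' i \<and> degree (v' i l) \<le> b' i"
      "(\<Sum>i\<in>I. a' i + b' i) < (\<Sum>i\<in>I. a i + b i)"
      by blast
    have "degree (wsum I u' v' j k) \<le> d" for j k
      unfolding *(1) by (rule less.prems(3))
    then show ?thesis
      unfolding *(1)[symmetric] by (rule less.hyps[OF *(3), rotated 2]) (use *(2) in auto)
  qed
qed

section \<open>Skew elimination and the rank\<close>

text \<open>Fraction-free elimination of rows and columns \<open>a\<close> and \<open>b\<close> with the skew pivot block at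
  \<open>{a, b}\<close>.\<close>

definition skew_elim :: "nat \<Rightarrow> nat \<Rightarrow> (nat \<Rightarrow> nat \<Rightarrow> 'a) \<Rightarrow> nat \<Rightarrow> nat \<Rightarrow> 'a::comm_ring_1" where
  "skew_elim a b P j k = P a b * P j k - (P j a * P k b - P j b * P k a)"

text \<open>This stands in for the rank: for alternating \<open>P\<close>, having
  \<open>Suc r\<close> successive pivots will mean normal rank above \<open>2 r\<close>. It uses
  only ring operations and nonvanishing, so it passes to fractions and to limits.\<close>

primrec pivotable :: "nat \<Rightarrow> (nat \<Rightarrow> nat \<Rightarrow> 'a::comm_ring_1) \<Rightarrow> bool" where
  "pivotable 0 P \<longleftrightarrow> True"
| "pivotable (Suc s) P \<longleftrightarrow> (\<exists>a b. P a b \<noteq> 0 \<and> pivotable s (skew_elim a b P))"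

text \<open>The diagonal is treated separately because \<open>P j j = - P j j\<close> does not force
  zero over a general commutative ring.\<close>

definition alternating :: "(nat \<Rightarrow> nat \<Rightarrow> 'a::comm_ring_1) \<Rightarrow> bool" where
  "alternating P \<longleftrightarrow> (\<forall>j k. P j k = - P k j) \<and> (\<forall>j. P j j = 0)"

lemma alternating_skew_elim:
  assumes "alternating P"
  shows "alternating (skew_elim a b P)"
proof -
  have s: "P k j = - P j k" for j k
    using assms unfolding alternating_def by blast
  have "skew_elim a b P j k = - skew_elim a b P k j" for j k
    unfolding skew_elim_def by (subst s[of j k]) (simp add: algebra_simps)
  moreover have "P j j = 0" for j using assms unfolding alternating_def by blast
  then have "skew_elim a b P j j = 0" for j by (simp add: skew_elim_def)
  ultimately show ?thesis unfolding alternating_def by blast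
qed

lemma skew_elim_pivot_columns:
  assumes "alternating P"
  shows "skew_elim a b P j a = 0" "skew_elim a b P j b = 0"
proof -
  have "P b a = - P a b" "P a a = 0" "P b b = 0"
    using assms unfolding alternating_def by blast+
  then show "skew_elim a b P j a = 0" "skew_elim a b P j b = 0"
    by (simp_all add: skew_elim_def)
qed

text \<open>Each elimination splits off the wedge product of the pivot columns \<open>a\<close> and
  \<open>b\<close> from \<open>P a b\<close> times \<open>P\<close>. After at most \<open>s\<close>
  eliminations nothing is left, and \<open>q\<close> collects the pivots.\<close>

lemma not_pivotable_imp_wsum:
  fixes P :: "nat \<Rightarrow> nat \<Rightarrow> 'a::idom"
  assumes "alternating P" "\<not> pivotable (Suc s) P"
  shows "\<exists>q u v. q \<noteq> 0 \<and> (\<forall>j k. q * P j k = wsum {..<s} u v j k)"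
  using assms
proof (induction s arbitrary: P)
  case 0
  then have "P j k = 0" for j k by auto
  then show ?case by (intro exI[of _ 1]) (simp add: wsum_def)
next
  case (Suc s)
  show ?case
  proof (cases "\<exists>a b. P a b \<noteq> 0")
    case False
    then show ?thesis
      by (intro exI[of _ 1] exI[of _ "\<lambda>_ _. 0"]) (simp add: wsum_def)
  next
    case True
    then obtain a b where ab: "P a b \<noteq> 0" by blast
    with Suc.prems(2) have "\<not> pivotable (Suc s) (skew_elim a b P)"
      unfolding pivotable.simps(2)[of "Suc s"] by blast
    with Suc.IH[OF alternating_skew_elim[OF Suc.prems(1)]] obtain q u v where
      q: "q \<noteq> 0" and w: "\<And>j k. q * skew_elim a b P j k = wsum {..<s} u v j k" by blast
    have "(q * P a b) * P j k =
        wsum {..<Suc s} (u(s := \<lambda>j. q * P j a)) (v(s := \<lambda>j. P j b)) j k" for j k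
    proof -
      have "{..<Suc s} - {s} = {..<s}" by auto
      then have "wsum {..<Suc s} (u(s := \<lambda>j. q * P j a)) (v(s := \<lambda>j. P j b)) j k
          = (q * P j a * P k b - P j b * (q * P k a)) + q * skew_elim a b P j k"
        by (simp add: wsum_fun_upd w)
      also have "\<dots> = (q * P a b) * P j k"
        by (simp add: skew_elim_def algebra_simps)
      finally show ?thesis ..
    qed
    moreover have "q * P a b \<noteq> 0" using q ab by simp
    ultimately show ?thesis by blast
  qed
qed

section \<open>Pivots and linearly independent columns\<close>

definition indep_columns :: "(nat \<Rightarrow> nat \<Rightarrow> 'a::comm_ring_1) \<Rightarrow> nat set \<Rightarrow> bool" where
  "indep_columns P S \<longleftrightarrow> (\<forall>x. (\<forall>j. (\<Sum>i\<in>S. x i * P j i) = 0) \<longrightarrow> (\<forall>i\<in>S. x i = 0))"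

lemma indep_columnsD:
  "indep_columns P S \<Longrightarrow> (\<And>j. (\<Sum>i\<in>S. x i * P j i) = 0) \<Longrightarrow> i \<in> S \<Longrightarrow> x i = 0"
  unfolding indep_columns_def by blast

lemma indep_columns_nonzero:
  assumes "indep_columns P S" "finite S" "i \<in> S"
  shows "\<exists>j. P j i \<noteq> 0"
proof (rule ccontr)
  assume "\<not> ?thesis"
  then have "(\<Sum>h\<in>S. (if h = i then 1 else 0) * P j h) = 0" for j
    by (intro sum.neutral) auto
  then show False
    using assms(1)[unfolded indep_columns_def, rule_format, of "\<lambda>h. if h = i then 1 else 0" i] \<open>i \<in> S\<close>
    by auto
qed

text \<open>The pivot columns \<open>a\<close> and \<open>b\<close> extend a set of independent
  columns of the eliminated matrix; they are new because elimination makes them zero there.\<close>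

lemma pivotable_imp_indep_columns:
  fixes P :: "nat \<Rightarrow> nat \<Rightarrow> 'a::idom"
  assumes "alternating P" "pivotable s P"
  shows "\<exists>S. finite S \<and> card S = 2 * s \<and> indep_columns P S"
  using assms
proof (induction s arbitrary: P)
  case 0
  then show ?case by (intro exI[of _ "{}"]) (simp add: indep_columns_def)
next
  case (Suc s)
  from Suc.prems(2) obtain a b where ab: "P a b \<noteq> 0" and piv: "pivotable s (skew_elim a b P)" by auto
  let ?E = "skew_elim a b P"
  have altE: "alternating ?E" using Suc.prems(1) by (rule alternating_skew_elim)
  obtain S where S: "finite S" "card S = 2 * s" "indep_columns ?E S"
    using Suc.IH[OF altE piv] by blast
  have z: "P a a = 0" "P b b = 0" and sk: "P j k = - P k j" for j k
    using Suc.prems(1) unfolding alternating_def by blast+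
  have ne: "a \<noteq> b" using ab z by auto
  have aS: "a \<notin> S" "b \<notin> S"
    using indep_columns_nonzero[OF S(3,1)] skew_elim_pivot_columns[OF Suc.prems(1)] by blast+
  have Erow: "?E a i = 0" "?E b i = 0" for i
    using altE skew_elim_pivot_columns[OF Suc.prems(1), of a b i]
    unfolding alternating_def by (metis neg_equal_0_iff_equal)+
  have "indep_columns P (insert a (insert b S))"
    unfolding indep_columns_def
  proof (intro allI impI)
    fix x assume x: "\<forall>j. (\<Sum>i\<in>insert a (insert b S). x i * P j i) = 0"
    have x': "(\<Sum>i\<in>S. x i * P j i) = - (x a * P j a) - x b * P j b" for j
      using x[rule_format, of j] S(1) aS ne by (simp add: algebra_simps eq_neg_iff_add_eq_0)
    \<comment> \<open>A relation for \<open>P\<close> becomes, after elimination, a combination of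
      the columns \<open>a\<close> and \<open>b\<close> of \<open>P\<close> with these coefficients.
      Rows \<open>a\<close> and \<open>b\<close> of the eliminated matrix are zero, which forces
      both to vanish.\<close>
    define \<alpha> \<beta> where "\<alpha> = - (P a b * x a) - (\<Sum>i\<in>S. x i * P i b)"
      and "\<beta> = - (P a b * x b) + (\<Sum>i\<in>S. x i * P i a)"
    have E: "(\<Sum>i\<in>S. x i * ?E j i) = P j a * \<alpha> + P j b * \<beta>" for j
    proof -
      have "(\<Sum>i\<in>S. x i * ?E j i) = (\<Sum>i\<in>S. P a b * (x i * P j i) - P j a * (x i * P i b) + P j b * (x i * P i a))"
        by (rule sum.cong) (simp_all add: skew_elim_def algebra_simps)
      also have "\<dots> = P a b * (\<Sum>i\<in>S. x i * P j i) - P j a * (\<Sum>i\<in>S. x i * P i b) + P j b * (\<Sum>i\<in>S. x i * P i a)"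
        by (simp only: sum.distrib sum_subtractf sum_distrib_left)
      also have "\<dots> = P j a * \<alpha> + P j b * \<beta>"
        unfolding x' \<alpha>_def \<beta>_def by (simp add: algebra_simps)
      finally show ?thesis .
    qed
    have "\<beta> = 0" using E[of a] z ab by (simp add: Erow)
    moreover have "\<alpha> = 0" using E[of b] z ab sk[of b a] by (simp add: Erow)
    ultimately have "\<forall>j. (\<Sum>i\<in>S. x i * ?E j i) = 0"
      by (simp add: E)
    then have "\<forall>i\<in>S. x i = 0"
      using S(3) unfolding indep_columns_def by blast
    then have "x a * P j a + x b * P j b = 0" for j
      using x'[of j] by (simp add: algebra_simps)
    from this[of a] this[of b] have "x b = 0" "x a = 0"
      using z ab sk[of b a] by simp_all
    then show "\<forall>i\<in>insert a (insert b S). x i = 0"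
      using \<open>\<forall>i\<in>S. x i = 0\<close> by simp
  qed
  moreover have "card (insert a (insert b S)) = 2 * Suc s"
    using S aS ne by simp
  ultimately show ?case
    using S(1) by (intro exI[of _ "insert a (insert b S)"] conjI finite.insertI)
qed

text \<open>Independence of a set of vectors ignores repetitions, so \<open>col\<close> is first
  shown injective on \<open>S\<close>. The support condition makes the unbounded index range of
  \<open>indep_columns\<close> agree with that of the matrix.\<close>

lemma (in vec_space) card_le_rank_of_indep_columns:
  fixes P :: "nat \<Rightarrow> nat \<Rightarrow> 'a"
  assumes "finite S" and ind: "indep_columns P S"
    and supp: "\<And>j k. \<not> (j < n \<and> k < nc) \<Longrightarrow> P j k = 0"
  shows "card S \<le> rank (mat n nc (\<lambda>(j, k). P j k))"
proof -
  let ?A = "mat n nc (\<lambda>(j, k). P j k)"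
  have lt: "i < nc" if "i \<in> S" for i
    using indep_columns_nonzero[OF ind \<open>finite S\<close> that] supp by blast
  have col: "col ?A i $ j = P j i" if "i \<in> S" "j < n" for i j
    using that lt by simp
  have inj: "inj_on (col ?A) S"
  proof (rule inj_onI, rule ccontr)
    fix h i assume hi: "h \<in> S" "i \<in> S" "col ?A h = col ?A i" "h \<noteq> i"
    have eq: "P j h = P j i" for j
      using hi col[of h j] col[of i j] supp by (cases "j < n") auto
    define x :: "nat \<Rightarrow> 'a" where "x = (\<lambda>l. if l = h then 1 else if l = i then - 1 else 0)"
    have "(\<Sum>l\<in>S. x l * P j l) = (\<Sum>l\<in>{h, i}. x l * P j l)" for j
      using hi \<open>finite S\<close> by (intro sum.mono_neutral_right) (auto simp: x_def)
    then have "(\<Sum>l\<in>S. x l * P j l) = 0" for j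
      using hi eq by (simp add: x_def)
    then have "x h = 0"
      using ind hi(1) unfolding indep_columns_def by blast
    then show False by (simp add: x_def)
  qed
  have sub: "col ?A ` S \<subseteq> set (cols ?A)"
    using lt by (auto simp: cols_def)
  have carr: "col ?A ` S \<subseteq> carrier_vec n" by (intro image_subsetI carrier_vecI) simp
  have "lin_indpt (col ?A ` S)"
  proof
    assume "lin_dep (col ?A ` S)"
    then obtain a w where w: "lincomb a (col ?A ` S) = 0\<^sub>v n" "w \<in> col ?A ` S" "a w \<noteq> 0"
      using finite_lin_dep[of "col ?A ` S"] \<open>finite S\<close> carr by auto
    have zero: "(\<Sum>i\<in>S. a (col ?A i) * P j i) = 0" for j
    proof (cases "j < n")
      case True
      have "lincomb a (col ?A ` S) $ j = (\<Sum>y\<in>col ?A ` S. a y * y $ j)"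
        by (rule lincomb_index[OF True carr])
      also have "\<dots> = (\<Sum>i\<in>S. a (col ?A i) * P j i)"
        using col[OF _ True] by (simp add: sum.reindex[OF inj])
      finally show ?thesis using w(1) True by simp
    qed (simp add: supp)
    have "a (col ?A i) = 0" if "i \<in> S" for i
      by (rule indep_columnsD[where x = "\<lambda>i. a (col ?A i)", OF ind zero that])
    with w show False by auto
  qed
  from rank_ge_card_indpt[OF _ sub this, of nc] show ?thesis
    by (simp add: card_image[OF inj])
qed

section \<open>Rank bounds for wedge sums and the pivot criterion for the normal rank\<close>

lemma (in vec_space) rank_sum_products_le:
  fixes f g :: "'i \<Rightarrow> nat \<Rightarrow> 'a"
  assumes "finite I"
  shows "rank (mat n nc (\<lambda>(j, k). \<Sum>i\<in>I. f i j * g i k)) \<le> card I"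
  using assms
proof (induction I)
  case empty
  have "mat n nc (\<lambda>(j, k). \<Sum>i\<in>{}. f i j * g i k) = 0\<^sub>m n nc"
    by (rule eq_matI) auto
  then show ?case using rank_0I by (simp only: card.empty)
next
  case (insert i I)
  let ?A = "mat n nc (\<lambda>(j, k). f i j * g i k)" and ?B = "mat n nc (\<lambda>(j, k). \<Sum>i\<in>I. f i j * g i k)"
  have "mat n nc (\<lambda>(j, k). \<Sum>i\<in>insert i I. f i j * g i k) = ?A + ?B"
    using insert by (intro eq_matI) auto
  moreover have "rank ?A \<le> 1"
    by (rule rank_le_1_product_entries[of _ nc "f i" "g i"]) auto
  ultimately show ?case
    using rank_subadditive[of ?A nc ?B] insert by simp
qed

text \<open>Every pair contributes two matrices of rank at most one; the disjoint union
  \<open>I <+> I\<close> indexes them.\<close>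

lemma (in vec_space) rank_wsum_le:
  fixes u v :: "'i \<Rightarrow> nat \<Rightarrow> 'a"
  assumes "finite I"
  shows "rank (mat n nc (\<lambda>(j, k). wsum I u v j k)) \<le> 2 * card I"
proof -
  have "wsum I u v j k = (\<Sum>x\<in>I <+> I. case_sum u (\<lambda>i j. - v i j) x j * case_sum v u x k)" for j k
    using assms by (simp add: wsum_def sum.Plus sum.distrib[symmetric])
  then show ?thesis
    using rank_sum_products_le[of "I <+> I" nc "case_sum u (\<lambda>i j. - v i j)" "case_sum v u"] assms
    by (simp add: card_Plus mult_2)
qed

lemma pivotable_to_fract:
  "pivotable s (\<lambda>j k. to_fract (P j k)) \<longleftrightarrow> pivotable s P"
proof (induction s arbitrary: P)
  case (Suc s)
  have "skew_elim a b (\<lambda>j k. to_fract (P j k)) = (\<lambda>j k. to_fract (skew_elim a b P j k))" for a b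
    by (simp add: skew_elim_def fun_eq_iff)
  with Suc show ?case by simp
qed simp

text \<open>\<open>Suc r\<close> pivots give \<open>2 r + 2\<close> independent columns over the
  fraction field. Without them a nonzero multiple \<open>q P\<close> is a sum of \<open>r\<close>
  wedge products, and \<open>q\<close> is invertible there.\<close>

lemma normal_rank_le_iff_not_pivotable:
  fixes P :: "nat \<Rightarrow> nat \<Rightarrow> complex poly"
  assumes alt: "alternating P" and supp: "\<And>j k. \<not> (j < m \<and> k < m) \<Longrightarrow> P j k = 0"
  shows "normal_rank (mat m m (\<lambda>(j, k). P j k)) \<le> 2 * r \<longleftrightarrow> \<not> pivotable (Suc r) P"
proof -
  let ?F = "\<lambda>j k. to_fract (P j k)"
  have "map_mat to_fract (mat m m (\<lambda>(j, k). P j k)) = mat m m (\<lambda>(j, k). ?F j k)"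
    by (rule eq_matI) auto
  then have nr: "normal_rank (mat m m (\<lambda>(j, k). P j k)) = vec_space.rank m (mat m m (\<lambda>(j, k). ?F j k))"
    by (simp add: normal_rank_def)
  show ?thesis
  proof
    assume le: "normal_rank (mat m m (\<lambda>(j, k). P j k)) \<le> 2 * r"
    show "\<not> pivotable (Suc r) P"
    proof
      assume "pivotable (Suc r) P"
      then have "pivotable (Suc r) ?F" by (simp only: pivotable_to_fract)
      moreover have "alternating ?F"
        using alt unfolding alternating_def by (metis to_fract_uminus to_fract_0)
      ultimately obtain S where "finite S" "card S = 2 * Suc r" "indep_columns ?F S"
        using pivotable_imp_indep_columns by blast
      then show False
        using vec_space.card_le_rank_of_indep_columns[of S ?F m m] supp le nr by auto
    qed
  next
    assume "\<not> pivotable (Suc r) P"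
    from not_pivotable_imp_wsum[OF alt this] obtain q u v where
      q: "q \<noteq> 0" and w: "\<And>j k. q * P j k = wsum {..<r} u v j k" by blast
    have "?F j k = wsum {..<r} (\<lambda>i j. to_fract (u i j) / to_fract q) (\<lambda>i j. to_fract (v i j)) j k" for j k
    proof -
      have "to_fract q * ?F j k = (\<Sum>i<r. to_fract (u i j) * to_fract (v i k) - to_fract (v i j) * to_fract (u i k))"
        using arg_cong[OF w, of to_fract j k] by (simp add: wsum_def)
      then have "?F j k = (\<Sum>i<r. to_fract (u i j) * to_fract (v i k) - to_fract (v i j) * to_fract (u i k)) / to_fract q"
        using q by (simp add: field_simps)
      then show ?thesis
        by (simp add: wsum_def sum_divide_distrib diff_divide_distrib)
    qed
    then show "normal_rank (mat m m (\<lambda>(j, k). P j k)) \<le> 2 * r"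
      unfolding nr using vec_space.rank_wsum_le[of "{..<r}" m m] by simp
  qed
qed

text \<open>A nonzero pivot polynomial is nonzero at some point \<open>x\<close>, and this persists
  nearby. Pointwise convergence is inherited by the eliminated matrices, whose entries are
  polynomial expressions in the old ones.\<close>

lemma pivotable_eventually:
  fixes P :: "nat \<Rightarrow> nat \<Rightarrow> 'a::real_normed_field poly"
  assumes "\<And>j k x. ((\<lambda>n. poly (Q n j k) x) \<longlongrightarrow> poly (P j k) x) F" "pivotable s P"
  shows "\<forall>\<^sub>F n in F. pivotable s (Q n)"
  using assms
proof (induction s arbitrary: P Q)
  case (Suc s)
  from Suc.prems(2) obtain a b where ab: "P a b \<noteq> 0" and piv: "pivotable s (skew_elim a b P)" by auto
  obtain x where "poly (P a b) x \<noteq> 0"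
    using ab by (metis poly_all_0_iff_0)
  then have "\<forall>\<^sub>F n in F. poly (Q n a b) x \<noteq> 0"
    using Suc.prems(1) by (rule tendsto_imp_eventually_ne[rotated])
  then have "\<forall>\<^sub>F n in F. Q n a b \<noteq> 0"
    by (rule eventually_mono) auto
  moreover have "\<forall>\<^sub>F n in F. pivotable s (skew_elim a b (Q n))"
    by (rule Suc.IH[OF _ piv]) (auto simp: skew_elim_def intro!: tendsto_intros Suc.prems(1))
  ultimately show ?case
    by eventually_elim auto
qed simp

section \<open>Closures\<close>

lemma POL_ss_closure_mono: "S \<subseteq> T \<Longrightarrow> POL_ss_closure d m S \<subseteq> POL_ss_closure d m T"
  unfolding POL_ss_closure_def by (rule closure_of_mono)

lemma POL_ss_closure_minimal:
  "S \<subseteq> POL_ss_closure d m T \<Longrightarrow> POL_ss_closure d m S \<subseteq> POL_ss_closure d m T"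
  unfolding POL_ss_closure_def by (rule closure_of_minimal) simp_all

lemma subset_POL_ss_closure: "S \<subseteq> POL_ss d m \<Longrightarrow> S \<subseteq> POL_ss_closure d m S"
  using Metric_space.topspace_mtopology[OF Metric_space_POL_ss]
  unfolding POL_ss_closure_def by (intro closure_of_subset) simp

text \<open>Along the ray \<open>P + \<epsilon> R\<close> the distance to \<open>P\<close> is
  \<open>\<epsilon>\<close> times a constant. Only some arbitrarily small \<open>\<epsilon>\<close>
  are required, which leaves room to avoid exceptional values.\<close>

lemma in_POL_ss_closureI:
  assumes P: "P \<in> POL_ss d m"
    and ex: "\<And>\<delta>. \<delta> > 0 \<Longrightarrow> \<exists>\<epsilon>. 0 < \<epsilon> \<and> \<epsilon> < \<delta> \<and>
      mat m m (\<lambda>(j, k). P $$ (j, k) + smult (complex_of_real \<epsilon>) (R j k)) \<in> S \<inter> POL_ss d m"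
  shows "P \<in> POL_ss_closure d m S"
proof -
  interpret Metric_space "POL_ss d m" "POL_dist d m" by (rule Metric_space_POL_ss)
  let ?I = "{..d} \<times> {..<m} \<times> {..<m}"
  define c where "c = L2_set (\<lambda>(i, j, k). cmod (coeff (R j k) i)) ?I"
  have c: "c \<ge> 0" by (simp add: c_def)
  have "\<exists>Q\<in>S. Q \<in> mball P e" if "e > 0" for e
  proof -
    \<comment> \<open>The summand one guards against \<open>c = 0\<close>.\<close>
    have "e / (c + 1) > 0" using that c by simp
    from ex[OF this] obtain \<epsilon> where \<epsilon>: "0 < \<epsilon>" "\<epsilon> < e / (c + 1)"
      "mat m m (\<lambda>(j, k). P $$ (j, k) + smult (complex_of_real \<epsilon>) (R j k)) \<in> S \<inter> POL_ss d m" by blast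
    let ?Q = "mat m m (\<lambda>(j, k). P $$ (j, k) + smult (complex_of_real \<epsilon>) (R j k))"
    have "POL_dist d m P ?Q = L2_set (\<lambda>x. \<epsilon> * (case x of (i, j, k) \<Rightarrow> cmod (coeff (R j k) i))) ?I"
      unfolding POL_dist_L2_set using \<epsilon>(1)
      by (intro L2_set_cong) (auto simp: norm_mult)
    also have "\<dots> = \<epsilon> * c"
      unfolding c_def using \<epsilon>(1) by (simp add: L2_set_right_distrib)
    also have "\<dots> \<le> \<epsilon> * (c + 1)" using \<epsilon>(1) by simp
    also have "\<dots> < e" using \<epsilon>(2) c by (simp add: field_simps)
    finally show ?thesis using P \<epsilon>(3) by (intro bexI[of _ ?Q]) auto
  qed
  then show ?thesis
    unfolding POL_ss_closure_def metric_closure_of using P by blast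
qed

lemma POL_ss_closureD:
  assumes "P \<in> POL_ss_closure d m S"
  shows "P \<in> POL_ss d m"
    and "\<exists>\<sigma>. range \<sigma> \<subseteq> S \<inter> POL_ss d m \<and> (\<lambda>n. POL_dist d m (\<sigma> n) P) \<longlonglongrightarrow> 0"
proof -
  interpret Metric_space "POL_ss d m" "POL_dist d m" by (rule Metric_space_POL_ss)
  show "P \<in> POL_ss d m"
    using assms unfolding POL_ss_closure_def metric_closure_of by blast
  show "\<exists>\<sigma>. range \<sigma> \<subseteq> S \<inter> POL_ss d m \<and> (\<lambda>n. POL_dist d m (\<sigma> n) P) \<longlonglongrightarrow> 0"
    using assms unfolding POL_ss_closure_def closure_of_sequentially limitin_metric_dist_null by blast
qed

section \<open>Entries of skew-symmetric matrix polynomials\<close>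

text \<open>Extension by zero matches the index range of \<open>wsum\<close> and
  \<open>pivotable\<close>; \<open>$$\<close> is unspecified outside the matrix.\<close>

definition entries :: "nat \<Rightarrow> 'a::zero mat \<Rightarrow> nat \<Rightarrow> nat \<Rightarrow> 'a" where
  "entries m P j k = (if j < m \<and> k < m then P $$ (j, k) else 0)"

lemma POL_ss_degree: "P \<in> POL_ss d m \<Longrightarrow> degree (entries m P j k) \<le> d"
  by (auto simp: POL_ss_def POL_grade_def entries_def)

lemma POL_ss_mat_entries:
  assumes "P \<in> POL_ss d m"
  shows "mat m m (\<lambda>(j, k). entries m P j k) = P"
  using assms by (intro eq_matI) (auto simp: POL_ss_def POL_grade_def POL_def entries_def)

lemma alternating_entries:
  assumes "P \<in> POL_ss d m"
  shows "alternating (entries m P)"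
proof -
  have sk: "P $$ (j, k) = - P $$ (k, j)" if "j < m" "k < m" for j k
  proof (rule poly_eqI)
    fix i
    show "coeff (P $$ (j, k)) i = coeff (- P $$ (k, j)) i"
    proof (cases "i \<le> d")
      case True
      then have "transpose_mat (coeff_matrix m m P i) = - coeff_matrix m m P i"
        using assms by (auto simp: POL_ss_def)
      from arg_cong[OF this, of "\<lambda>A. A $$ (k, j)"] show ?thesis
        using that by (simp add: coeff_matrix_def)
    next
      case False
      moreover have "degree (P $$ (j, k)) \<le> d" "degree (P $$ (k, j)) \<le> d"
        using assms that by (auto simp: POL_ss_def POL_grade_def)
      ultimately show ?thesis by (simp add: coeff_eq_0)
    qed
  qed
  \<comment> \<open>Characteristic zero yields the zero diagonal.\<close>
  have "p = 0" if "p = - p" for p :: "complex poly"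
  proof (rule poly_eqI)
    fix i
    have "coeff p i = - coeff p i" by (metis that coeff_minus)
    then show "coeff p i = coeff 0 i" by simp
  qed
  with sk have "P $$ (j, j) = 0" if "j < m" for j using that by blast
  then have "entries m P j j = 0" for j by (simp add: entries_def)
  moreover have "entries m P j k = - entries m P k j" for j k
    using sk[of j k] by (auto simp: entries_def)
  ultimately show ?thesis unfolding alternating_def by blast
qed

section \<open>The rank bound is a closed condition\<close>

lemma POL_ss_rank_iff:
  assumes "P \<in> POL_ss d m"
  shows "P \<in> POL_ss_rank d (2 * r) m \<longleftrightarrow> \<not> pivotable (Suc r) (entries m P)"
proof -
  have "entries m P j k = 0" if "\<not> (j < m \<and> k < m)" for j k
    using that by (auto simp: entries_def)
  from normal_rank_le_iff_not_pivotable[of "entries m P" m r, OF alternating_entries[OF assms] this] assms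
  show ?thesis
    by (simp add: POL_ss_mat_entries[OF assms] POL_ss_rank_def del: pivotable.simps)
qed

lemma poly_eq_sum_coeff:
  fixes p :: "'a::comm_semiring_1 poly"
  assumes "degree p \<le> d"
  shows "poly p x = (\<Sum>i\<le>d. coeff p i * x ^ i)"
  unfolding poly_altdef using assms by (intro sum.mono_neutral_left) (auto simp: coeff_eq_0)

lemma POL_ss_closure_rank: "POL_ss_closure d m (POL_ss_rank d (2 * r) m) \<subseteq> POL_ss_rank d (2 * r) m"
proof
  fix P assume P: "P \<in> POL_ss_closure d m (POL_ss_rank d (2 * r) m)"
  have PM: "P \<in> POL_ss d m" by (rule POL_ss_closureD(1)[OF P])
  obtain \<sigma> where \<sigma>: "range \<sigma> \<subseteq> POL_ss_rank d (2 * r) m \<inter> POL_ss d m"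
    and lim: "(\<lambda>n. POL_dist d m (\<sigma> n) P) \<longlonglongrightarrow> 0"
    using POL_ss_closureD(2)[OF P] by blast
  have \<sigma>M: "\<sigma> n \<in> POL_ss d m" for n using \<sigma> by blast
  have lim_coeff: "(\<lambda>n. coeff (entries m (\<sigma> n) j k) i) \<longlonglongrightarrow> coeff (entries m P j k) i"
    if "i \<le> d" for i j k
  proof (cases "j < m \<and> k < m")
    case True
    have "cmod (coeff (\<sigma> n $$ (j, k)) i - coeff (P $$ (j, k)) i) \<le> POL_dist d m (\<sigma> n) P" for n
      using member_le_L2_set[of "{..d} \<times> {..<m} \<times> {..<m}" "(i, j, k)"
          "\<lambda>(i, j, k). cmod (coeff (\<sigma> n $$ (j, k)) i - coeff (P $$ (j, k)) i)"] that True
      by (simp add: POL_dist_L2_set)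
    then have "(\<lambda>n. coeff (\<sigma> n $$ (j, k)) i - coeff (P $$ (j, k)) i) \<longlonglongrightarrow> 0"
      by (intro Lim_null_comparison[OF _ lim]) simp
    then show ?thesis
      using True by (simp add: entries_def LIM_zero_iff)
  next
    case False
    then have "entries m Q j k = 0" for Q :: "complex poly mat" by (auto simp: entries_def)
    then show ?thesis by simp
  qed
  \<comment> \<open>The common degree bound \<open>d\<close> writes all values as sums over one
    index range, so convergence of coefficients suffices.\<close>
  have "(\<lambda>n. poly (entries m (\<sigma> n) j k) x) \<longlonglongrightarrow> poly (entries m P j k) x" for j k x
    unfolding poly_eq_sum_coeff[OF POL_ss_degree[OF PM]] poly_eq_sum_coeff[OF POL_ss_degree[OF \<sigma>M]]
    by (intro tendsto_intros lim_coeff) auto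
  then have ev: "pivotable (Suc r) (entries m P) \<Longrightarrow> \<forall>\<^sub>F n in sequentially. pivotable (Suc r) (entries m (\<sigma> n))"
    by (rule pivotable_eventually)
  have "\<not> pivotable (Suc r) (entries m (\<sigma> n))" for n
    using POL_ss_rank_iff[OF \<sigma>M, of n r] \<sigma> by blast
  with ev have "\<not> pivotable (Suc r) (entries m P)"
    unfolding eventually_sequentially by blast
  then show "P \<in> POL_ss_rank d (2 * r) m"
    using POL_ss_rank_iff[OF PM] by blast
qed

section \<open>The factorised sets as sums of wedge products\<close>

lemma degree_wsum_le:
  assumes "\<And>i. i \<in> I \<Longrightarrow> degree (u i j) + degree (v i k) \<le> d"
    "\<And>i. i \<in> I \<Longrightarrow> degree (v i j) + degree (u i k) \<le> d" "finite I"
  shows "degree (wsum I u v j k) \<le> d"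
  unfolding wsum_def using assms
  by (intro degree_sum_le degree_diff_le order.trans[OF degree_mult_le]) auto

lemma mat_wsum_in_POL_ss:
  assumes "\<And>j k. j < m \<Longrightarrow> k < m \<Longrightarrow> degree (wsum I u v j k) \<le> d"
  shows "mat m m (\<lambda>(j, k). wsum I u v j k) \<in> POL_ss d m"
proof -
  have "transpose_mat (coeff_matrix m m (mat m m (\<lambda>(j, k). wsum I u v j k)) i)
      = - coeff_matrix m m (mat m m (\<lambda>(j, k). wsum I u v j k)) i" for i
  proof (rule eq_matI)
    fix j k
    assume jk: "j < dim_row (- coeff_matrix m m (mat m m (\<lambda>(j, k). wsum I u v j k)) i)"
      "k < dim_col (- coeff_matrix m m (mat m m (\<lambda>(j, k). wsum I u v j k)) i)"
    have "coeff (wsum I u v k j) i = - coeff (wsum I u v j k) i"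
      by (subst wsum_skew) simp
    with jk show "transpose_mat (coeff_matrix m m (mat m m (\<lambda>(j, k). wsum I u v j k)) i) $$ (j, k)
      = (- coeff_matrix m m (mat m m (\<lambda>(j, k). wsum I u v j k)) i) $$ (j, k)"
      by (simp add: coeff_matrix_def)
  qed (simp_all add: coeff_matrix_def)
  then show ?thesis
    using assms by (auto simp: POL_ss_def POL_grade_def POL_def)
qed

section \<open>The set \<open>G_ss\<close> in terms of wedge sums\<close>

lemma nat_floor_half: "nat \<lfloor>real d / 2\<rfloor> = d div 2"
  using floor_divide_of_nat_eq[of d 2, where 'a = real] by simp

lemma nat_ceiling_half: "nat \<lceil>real d / 2\<rceil> = d - d div 2"
proof -
  have "real d = 2 * real (d div 2) + real (d mod 2)"
    by (metis div_mult_mod_eq mult.commute of_nat_add of_nat_mult of_nat_numeral)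
  moreover have "d = 2 * (d div 2) + d mod 2" by simp
  ultimately have "\<lceil>real d / 2\<rceil> = int (d - d div 2)"
    by (cases "even d") (auto intro!: ceiling_unique simp: of_nat_diff odd_iff_mod_2_eq_one even_iff_mod_2_eq_zero)
  then show ?thesis by simp
qed

lemma G_ss_eq_wsum:
  "G_ss d r m = {mat m m (\<lambda>(j, k). wsum {..<r} u v j k) | u v.
     \<forall>i<r. \<forall>j<m. degree (u i j) \<le> d div 2 \<and> degree (v i j) \<le> d - d div 2}"
proof (intro Set.set_eqI iffI)
  fix P assume "P \<in> G_ss d r m"
  then obtain U V where UV: "V \<in> POL_grade (d - d div 2) m r" "U \<in> POL_grade (d div 2) m r"
    and P: "P = U * transpose_mat V - V * transpose_mat U"
    unfolding G_ss_def nat_floor_half nat_ceiling_half by blast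
  have "U \<in> carrier_mat m r" "V \<in> carrier_mat m r"
    using UV by (auto simp: POL_grade_def POL_def)
  then have "P = mat m m (\<lambda>(j, k). wsum {..<r} (\<lambda>i j. U $$ (j, i)) (\<lambda>i j. V $$ (j, i)) j k)"
    unfolding P by (intro eq_matI)
      (auto simp: wsum_def scalar_prod_def sum_subtractf atLeast0LessThan)
  then show "P \<in> {mat m m (\<lambda>(j, k). wsum {..<r} u v j k) | u v.
      \<forall>i<r. \<forall>j<m. degree (u i j) \<le> d div 2 \<and> degree (v i j) \<le> d - d div 2}"
    using UV unfolding POL_grade_def
    by (intro CollectI exI[of _ "\<lambda>i j. U $$ (j, i)"] exI[of _ "\<lambda>i j. V $$ (j, i)"]) auto
next
  fix P :: "complex poly mat"
  assume "P \<in> {mat m m (\<lambda>(j, k). wsum {..<r} u v j k) | u v.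
      \<forall>i<r. \<forall>j<m. degree (u i j) \<le> d div 2 \<and> degree (v i j) \<le> d - d div 2}"
  then obtain u v where P: "P = mat m m (\<lambda>(j, k). wsum {..<r} u v j k)"
    and uv: "\<forall>i<r. \<forall>j<m. degree (u i j) \<le> d div 2 \<and> degree (v i j) \<le> d - d div 2" by blast
  let ?U = "mat m r (\<lambda>(j, i). u i j)" and ?V = "mat m r (\<lambda>(j, i). v i j)"
  have "P = ?U * transpose_mat ?V - ?V * transpose_mat ?U"
    unfolding P by (intro eq_matI) (auto simp: wsum_def scalar_prod_def sum_subtractf atLeast0LessThan)
  moreover have "?V \<in> POL_grade (d - d div 2) m r" "?U \<in> POL_grade (d div 2) m r"
    using uv by (auto simp: POL_grade_def POL_def)
  ultimately show "P \<in> G_ss d r m"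
    unfolding G_ss_def nat_floor_half nat_ceiling_half by blast
qed

lemma G_ss_subset_POL_ss: "G_ss d r m \<subseteq> POL_ss d m"
proof
  fix P assume "P \<in> G_ss d r m"
  then obtain u v where P: "P = mat m m (\<lambda>(j, k). wsum {..<r} u v j k)"
    and uv: "\<forall>i<r. \<forall>j<m. degree (u i j) \<le> d div 2 \<and> degree (v i j) \<le> d - d div 2"
    unfolding G_ss_eq_wsum by blast
  have "degree (u i j) + degree (v i k) \<le> d" if "i < r" "j < m" "k < m" for i j k
    using uv[rule_format, OF that(1,2)] uv[rule_format, OF that(1,3)] by linarith
  then show "P \<in> POL_ss d m"
    unfolding P by (intro mat_wsum_in_POL_ss degree_wsum_le) (auto simp: add.commute)
qed

lemma G_ss_subset_POL_ss_rank: "G_ss d r m \<subseteq> POL_ss_rank d (2 * r) m"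
proof
  fix P assume P: "P \<in> G_ss d r m"
  then obtain u v where "P = mat m m (\<lambda>(j, k). wsum {..<r} u v j k)"
    unfolding G_ss_eq_wsum by blast
  then have "map_mat to_fract P = mat m m (\<lambda>(j, k).
      wsum {..<r} (\<lambda>i j. to_fract (u i j)) (\<lambda>i j. to_fract (v i j)) j k)" and "dim_row P = m"
    by (auto intro!: eq_matI simp: wsum_def)
  then have "normal_rank P \<le> 2 * r"
    using vec_space.rank_wsum_le[of "{..<r}" m m] by (simp add: normal_rank_def)
  then show "P \<in> POL_ss_rank d (2 * r) m"
    using P G_ss_subset_POL_ss by (auto simp: POL_ss_rank_def)
qed

section \<open>The antidiagonal form and the set \<open>A_set\<close> in terms of wedge sums\<close>

lemma skew_antidiag_mat_index:
  assumes "a < 2 * r" "b < 2 * r"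
  shows "skew_antidiag_mat r $$ (a, b) = (if a = 2 * r - 1 - b then (if a < r then 1 else - 1) else 0)"
  using assms unfolding skew_antidiag_mat_def antidiag_mat_def
  by (auto simp: mult_2)

lemma sum_pair_reflect: "(\<Sum>b<2 * r. f b) = (\<Sum>i<r. f i + f (2 * r - 1 - i))"
  for f :: "nat \<Rightarrow> 'a::comm_monoid_add"
proof -
  have "(\<Sum>b<2 * r. f b) = (\<Sum>b<r. f b) + (\<Sum>b\<in>{r..<2 * r}. f b)"
    by (subst sum.union_disjoint[symmetric]) (auto intro!: sum.cong)
  also have "(\<Sum>b\<in>{r..<2 * r}. f b) = (\<Sum>i<r. f (2 * r - 1 - i))"
    by (rule sum.reindex_bij_witness[of _ "\<lambda>i. 2 * r - 1 - i" "\<lambda>i. 2 * r - 1 - i"]) auto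
  finally show ?thesis by (simp add: sum.distrib)
qed

text \<open>The antidiagonal form exchanges column \<open>i\<close> with its partner
  \<open>2 * r - 1 - i\<close> up to sign. The partner, of complementary degree in
  \<open>A_set\<close>, is taken negated as first vector, which matches the order of
  \<open>U\<close> and \<open>V\<close> in \<open>G_ss\<close>.\<close>

lemma skew_antidiag_congruence:
  assumes L: "L \<in> carrier_mat m (2 * r)"
  shows "L * skew_antidiag_mat r * transpose_mat L = mat m m (\<lambda>(j, k).
    wsum {..<r} (\<lambda>i j. - L $$ (j, 2 * r - 1 - i)) (\<lambda>i j. L $$ (j, i)) j k)"
proof -
  have dim: "dim_row (skew_antidiag_mat r) = 2 * r" "dim_col (skew_antidiag_mat r) = 2 * r"
    by (simp_all add: skew_antidiag_mat_def antidiag_mat_def mult_2)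
  have LJ: "(L * skew_antidiag_mat r) $$ (j, b) = (if b < r then - 1 else 1) * L $$ (j, 2 * r - 1 - b)"
    if "j < m" "b < 2 * r" for j b
  proof -
    have "(L * skew_antidiag_mat r) $$ (j, b) = (\<Sum>a<2 * r. L $$ (j, a) * skew_antidiag_mat r $$ (a, b))"
      using that L dim by (simp add: scalar_prod_def atLeast0LessThan)
    also have "\<dots> = (\<Sum>a<2 * r. if a = 2 * r - 1 - b then L $$ (j, a) * (if a < r then 1 else - 1) else 0)"
      using that by (intro sum.cong) (auto simp: skew_antidiag_mat_index)
    also have "\<dots> = L $$ (j, 2 * r - 1 - b) * (if 2 * r - 1 - b < r then 1 else - 1)"
      using that by (simp add: sum.delta)
    also have "\<dots> = (if b < r then - 1 else 1) * L $$ (j, 2 * r - 1 - b)"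
      using that by auto
    finally show ?thesis .
  qed
  show ?thesis
  proof (rule eq_matI)
    fix j k assume "j < dim_row (mat m m (\<lambda>(j, k).
      wsum {..<r} (\<lambda>i j. - L $$ (j, 2 * r - 1 - i)) (\<lambda>i j. L $$ (j, i)) j k))"
      "k < dim_col (mat m m (\<lambda>(j, k).
      wsum {..<r} (\<lambda>i j. - L $$ (j, 2 * r - 1 - i)) (\<lambda>i j. L $$ (j, i)) j k))"
    then have jk: "j < m" "k < m" by auto
    have "(L * skew_antidiag_mat r * transpose_mat L) $$ (j, k)
        = (\<Sum>b<2 * r. (L * skew_antidiag_mat r) $$ (j, b) * L $$ (k, b))"
      using jk L dim by (simp add: scalar_prod_def atLeast0LessThan)
    also have "\<dots> = (\<Sum>b<2 * r. (if b < r then - 1 else 1) * L $$ (j, 2 * r - 1 - b) * L $$ (k, b))"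
      using LJ jk by (intro sum.cong) auto
    also have "\<dots> = (\<Sum>i<r. - L $$ (j, 2 * r - 1 - i) * L $$ (k, i) + L $$ (j, i) * L $$ (k, 2 * r - 1 - i))"
      unfolding sum_pair_reflect by (intro sum.cong) auto
    finally show "(L * skew_antidiag_mat r * transpose_mat L) $$ (j, k) = mat m m (\<lambda>(j, k).
      wsum {..<r} (\<lambda>i j. - L $$ (j, 2 * r - 1 - i)) (\<lambda>i j. L $$ (j, i)) j k) $$ (j, k)"
      using jk by (simp add: wsum_def)
  qed (use L in auto)
qed

lemma has_vec_degree_iff:
  assumes "v \<in> carrier_vec m"
  shows "has_vec_degree v n \<longleftrightarrow> (\<exists>j<m. coeff (v $ j) n \<noteq> 0) \<and> (\<forall>j<m. degree (v $ j) \<le> n)"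
proof -
  have "map_vec (\<lambda>p. coeff p i) v = 0\<^sub>v (dim_vec v) \<longleftrightarrow> (\<forall>j<m. coeff (v $ j) i = 0)" for i
    using assms by (auto simp: vec_eq_iff)
  moreover have "(\<forall>i>n. \<forall>j<m. coeff (v $ j) i = 0) \<longleftrightarrow> (\<forall>j<m. degree (v $ j) \<le> n)"
    by (auto intro: degree_le simp: coeff_eq_0)
  ultimately show ?thesis by (auto simp: has_vec_degree_def)
qed

lemma has_vec_degree_col_iff:
  assumes "L \<in> carrier_mat m c" "i < c"
  shows "has_vec_degree (col L i) n \<longleftrightarrow>
    (\<exists>j<m. coeff (L $$ (j, i)) n \<noteq> 0) \<and> (\<forall>j<m. degree (L $$ (j, i)) \<le> n)"
proof -
  have "col L i \<in> carrier_vec m" using assms by (intro carrier_vecI) auto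
  moreover have "col L i $ j = L $$ (j, i)" if "j < m" for j using assms that by simp
  ultimately show ?thesis by (simp add: has_vec_degree_iff cong: conj_cong)
qed

text \<open>In this form the set differs from \<open>G_ss\<close> only in that every degree bound
  must be attained.\<close>

lemma A_set_eq_wsum:
  "A_set d m (replicate r (d - d div 2)) = {mat m m (\<lambda>(j, k). wsum {..<r} u v j k) | u v.
     \<forall>i<r. (\<exists>j<m. coeff (u i j) (d div 2) \<noteq> 0) \<and> (\<exists>j<m. coeff (v i j) (d - d div 2) \<noteq> 0) \<and>
       (\<forall>j<m. degree (u i j) \<le> d div 2 \<and> degree (v i j) \<le> d - d div 2)}"
proof (intro Set.set_eqI iffI)
  have dd: "d - (d - d div 2) = d div 2" by simp
  fix P :: "complex poly mat"
  {
    assume "P \<in> A_set d m (replicate r (d - d div 2))"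
    then obtain L where L: "L \<in> carrier_mat m (2 * r)" and P: "P = L * skew_antidiag_mat r * transpose_mat L"
      and deg: "\<forall>i<r. has_vec_degree (col L i) (d - d div 2) \<and> has_vec_degree (col L (2 * r - 1 - i)) (d div 2)"
      unfolding A_set_def POL_def by (auto simp: dd)
    have deg': "(\<exists>j<m. coeff (L $$ (j, i)) (d - d div 2) \<noteq> 0) \<and> (\<forall>j<m. degree (L $$ (j, i)) \<le> d - d div 2) \<and>
      (\<exists>j<m. coeff (L $$ (j, 2 * r - 1 - i)) (d div 2) \<noteq> 0) \<and>
      (\<forall>j<m. degree (L $$ (j, 2 * r - 1 - i)) \<le> d div 2)" if "i < r" for i
      using deg[rule_format, OF that] that
        has_vec_degree_col_iff[OF L, of i] has_vec_degree_col_iff[OF L, of "2 * r - 1 - i"] by simp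
    show "P \<in> {mat m m (\<lambda>(j, k). wsum {..<r} u v j k) | u v.
      \<forall>i<r. (\<exists>j<m. coeff (u i j) (d div 2) \<noteq> 0) \<and> (\<exists>j<m. coeff (v i j) (d - d div 2) \<noteq> 0) \<and>
       (\<forall>j<m. degree (u i j) \<le> d div 2 \<and> degree (v i j) \<le> d - d div 2)}"
      unfolding P skew_antidiag_congruence[OF L] using deg'
      by (intro CollectI exI[of _ "\<lambda>i j. - L $$ (j, 2 * r - 1 - i)"] exI[of _ "\<lambda>i j. L $$ (j, i)"]) auto
  }
  assume "P \<in> {mat m m (\<lambda>(j, k). wsum {..<r} u v j k) | u v.
      \<forall>i<r. (\<exists>j<m. coeff (u i j) (d div 2) \<noteq> 0) \<and> (\<exists>j<m. coeff (v i j) (d - d div 2) \<noteq> 0) \<and>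
       (\<forall>j<m. degree (u i j) \<le> d div 2 \<and> degree (v i j) \<le> d - d div 2)}"
  then obtain u v where P: "P = mat m m (\<lambda>(j, k). wsum {..<r} u v j k)"
    and uv: "\<forall>i<r. (\<exists>j<m. coeff (u i j) (d div 2) \<noteq> 0) \<and> (\<exists>j<m. coeff (v i j) (d - d div 2) \<noteq> 0) \<and>
       (\<forall>j<m. degree (u i j) \<le> d div 2 \<and> degree (v i j) \<le> d - d div 2)" by blast
  \<comment> \<open>The last \<open>r\<close> columns carry the negated \<open>u\<close> in reverse
    order, which inverts the congruence formula.\<close>
  define L where "L = mat m (2 * r) (\<lambda>(j, a). if a < r then v a j else - u (2 * r - 1 - a) j)"
  have L: "L \<in> carrier_mat m (2 * r)" by (simp add: L_def)
  have Li: "L $$ (j, i) = v i j" "L $$ (j, 2 * r - 1 - i) = - u i j" if "i < r" "j < m" for i j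
    using that by (auto simp: L_def)
  have "L * skew_antidiag_mat r * transpose_mat L = P"
    unfolding skew_antidiag_congruence[OF L] P
    by (intro eq_matI) (auto simp: wsum_def L_def intro!: sum.cong)
  moreover have "has_vec_degree (col L i) (d - d div 2) \<and> has_vec_degree (col L (2 * r - 1 - i)) (d div 2)"
    if "i < r" for i
    using uv[rule_format, OF that] that Li[OF that]
      has_vec_degree_col_iff[OF L, of i] has_vec_degree_col_iff[OF L, of "2 * r - 1 - i"]
    by (simp cong: conj_cong)
  ultimately show "P \<in> A_set d m (replicate r (d - d div 2))"
    using L unfolding A_set_def POL_def by (auto simp: dd)
qed

section \<open>Balancing the degrees in the limit\<close>

text \<open>Each pair may split the total degree \<open>d\<close> in its own way;
  \<open>a i = d div 2\<close> is the balanced case.\<close>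

definition graded_wsums :: "nat \<Rightarrow> nat \<Rightarrow> nat \<Rightarrow> (nat \<Rightarrow> nat) \<Rightarrow> complex poly mat set" where
  "graded_wsums d m r a = {mat m m (\<lambda>(j, k). wsum {..<r} u v j k) | u v.
     \<forall>i<r. \<forall>j. degree (u i j) \<le> a i \<and> degree (v i j) \<le> d - a i}"

lemma graded_wsums_subset_POL_ss:
  assumes "\<forall>i<r. a i \<le> d"
  shows "graded_wsums d m r a \<subseteq> POL_ss d m"
proof
  fix P assume "P \<in> graded_wsums d m r a"
  then obtain u v where P: "P = mat m m (\<lambda>(j, k). wsum {..<r} u v j k)"
    and uv: "\<forall>i<r. \<forall>j. degree (u i j) \<le> a i \<and> degree (v i j) \<le> d - a i"
    unfolding graded_wsums_def by blast
  have "degree (u i j) + degree (v i k) \<le> d" if "i < r" for i j k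
    using uv[rule_format, OF that, of j] uv[rule_format, OF that, of k] assms[rule_format, OF that]
    by linarith
  then show "P \<in> POL_ss d m"
    unfolding P by (intro mat_wsum_in_POL_ss degree_wsum_le) (auto simp: add.commute)
qed

text \<open>With \<open>w\<close> the coefficient of \<open>\<lambda>\<^bsup>b\<^esup>\<close> in \<open>v\<close>, the pair \<open>u + \<epsilon> w \<lambda>\<^bsup>a + 1\<^esup>\<close> and
  \<open>v - \<epsilon>\<^sup>-\<^sup>1 \<lambda>\<^bsup>b - a - 1\<^esup> (u + \<epsilon> w \<lambda>\<^bsup>a + 1\<^esup>)\<close> has degrees at most \<open>a + 1\<close> and \<open>b - 1\<close>, and its wedge
  product tends to that of \<open>u\<close> and \<open>v\<close> although the second vector diverges.\<close>

lemma graded_wsums_shift: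
  assumes i: "i < r" and a: "\<forall>i<r. a i \<le> d" and ai: "a i < d div 2"
  shows "graded_wsums d m r a \<subseteq> POL_ss_closure d m (graded_wsums d m r (a(i := Suc (a i))))"
proof
  fix P assume PG: "P \<in> graded_wsums d m r a"
  then obtain u v where P: "P = mat m m (\<lambda>(j, k). wsum {..<r} u v j k)"
    and uv: "\<forall>i<r. \<forall>j. degree (u i j) \<le> a i \<and> degree (v i j) \<le> d - a i"
    unfolding graded_wsums_def by blast
  define b where "b = d - a i"
  have b: "Suc (a i) \<le> b" "d - Suc (a i) = b - 1" using ai by (auto simp: b_def)
  define w where "w = (\<lambda>j. coeff (v i j) b)"
  \<comment> \<open>The second new vector differs from \<open>v i\<close> by a multiple of the
    first, so the new wedge product is that of the first with \<open>v i\<close>: exactly linear in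
    \<open>\<epsilon>\<close>, with slope \<open>R\<close>.\<close>
  define R where "R = (\<lambda>j k. monom (w j) (Suc (a i)) * v i k - v i j * monom (w k) (Suc (a i)))"
  have a': "\<forall>h<r. (a(i := Suc (a i))) h \<le> d" using a ai by auto
  show "P \<in> POL_ss_closure d m (graded_wsums d m r (a(i := Suc (a i))))"
  proof (rule in_POL_ss_closureI[where R = R])
    show "P \<in> POL_ss d m" using PG graded_wsums_subset_POL_ss[OF a] by blast
    fix \<delta> :: real assume "\<delta> > 0"
    define \<epsilon> where "\<epsilon> = \<delta> / 2"
    have \<epsilon>: "0 < \<epsilon>" "\<epsilon> < \<delta>" using \<open>\<delta> > 0\<close> by (auto simp: \<epsilon>_def)
    define e where "e = complex_of_real \<epsilon>"
    have e: "e \<noteq> 0" using \<epsilon> by (simp add: e_def)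
    define x where "x = (\<lambda>j. u i j + monom (e * w j) (Suc (a i)))"
    define t where "t = monom (1 / e) (b - Suc (a i))"
    define y where "y = (\<lambda>j. v i j - t * x j)"
    have eq: "wsum {..<r} (u(i := x)) (v(i := y)) j k = wsum {..<r} u v j k + smult e (R j k)" for j k
    proof -
      have "x j * y k - y j * x k = x j * v i k - v i j * x k"
        by (simp add: y_def algebra_simps)
      also have "\<dots> = (u i j * v i k - v i j * u i k) + smult e (R j k)"
        by (simp add: x_def R_def algebra_simps smult_diff_right flip: smult_monom)
      finally show ?thesis
        using i by (simp add: wsum_fun_upd wsum_remove[of "{..<r}" i u v])
    qed
    have degx: "degree (x j) \<le> Suc (a i)" for j
      using uv[rule_format, OF i, of j] unfolding x_def
      by (intro degree_add_le) (auto intro: degree_monom_le)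
    have degy: "degree (y j) \<le> b - 1" for j
    proof -
      \<comment> \<open>The factor \<open>1 / e\<close> in \<open>t\<close> undoes \<open>e\<close>,
        so for every \<open>\<epsilon>\<close> this product is the term of \<open>v i\<close> at
        \<open>b\<close> and cancels it.\<close>
      have "t * monom (e * w j) (Suc (a i)) = monom (w j) b"
        using e b(1) by (simp add: t_def mult_monom)
      then have "y j = (v i j - monom (w j) b) - t * u i j"
        by (simp add: y_def x_def algebra_simps)
      moreover have "degree (v i j - monom (w j) b) \<le> b - 1"
      proof (rule degree_le_diff_1)
        show "degree (v i j - monom (w j) b) \<le> b"
          using uv[rule_format, OF i, of j] by (intro degree_diff_le degree_monom_le) (simp add: b_def)
        show "coeff (v i j - monom (w j) b) b = 0" by (simp add: w_def)
      qed
      moreover have "degree (t * u i j) \<le> b - 1"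
      proof -
        have "degree (t * u i j) \<le> (b - Suc (a i)) + a i"
          using uv[rule_format, OF i, of j] unfolding t_def
          by (intro order.trans[OF degree_mult_le] add_mono degree_monom_le) auto
        also have "\<dots> = b - 1" using b(1) by simp
        finally show ?thesis .
      qed
      ultimately show ?thesis by (simp add: degree_diff_le)
    qed
    let ?Q = "mat m m (\<lambda>(j, k). P $$ (j, k) + smult (complex_of_real \<epsilon>) (R j k))"
    have "?Q = mat m m (\<lambda>(j, k). wsum {..<r} (u(i := x)) (v(i := y)) j k)"
      by (rule eq_matI) (auto simp: P eq e_def)
    moreover have "\<forall>h<r. \<forall>j. degree ((u(i := x)) h j) \<le> (a(i := Suc (a i))) h \<and>
        degree ((v(i := y)) h j) \<le> d - (a(i := Suc (a i))) h"
      using uv degx degy b(2) by auto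
    ultimately have "?Q \<in> graded_wsums d m r (a(i := Suc (a i)))"
      unfolding graded_wsums_def by blast
    with \<epsilon> show "\<exists>\<epsilon>. 0 < \<epsilon> \<and> \<epsilon> < \<delta> \<and> mat m m (\<lambda>(j, k). P $$ (j, k) + smult (complex_of_real \<epsilon>) (R j k))
        \<in> graded_wsums d m r (a(i := Suc (a i))) \<inter> POL_ss d m"
      using graded_wsums_subset_POL_ss[OF a'] by blast
  qed
qed

text \<open>Shifts raise the bounds one unit at a time to \<open>d div 2\<close>, with the total
  deficit as measure. Closures being closed, the successive limits combine into one.\<close>

lemma graded_wsums_subset_closure_G_ss:
  assumes "\<forall>i<r. a i \<le> d div 2"
  shows "graded_wsums d m r a \<subseteq> POL_ss_closure d m (G_ss d r m)"
  using assms
proof (induction "\<Sum>i<r. d div 2 - a i" arbitrary: a rule: less_induct)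
  case less
  show ?case
  proof (cases "\<exists>i<r. a i < d div 2")
    case True
    then obtain i where i: "i < r" "a i < d div 2" by blast
    let ?a = "a(i := Suc (a i))"
    have "(\<Sum>h<r. d div 2 - ?a h) < (\<Sum>h<r. d div 2 - a h)"
      using i by (intro sum_strict_mono_ex1) auto
    moreover have "\<forall>h<r. ?a h \<le> d div 2" using less.prems i by auto
    ultimately have "graded_wsums d m r ?a \<subseteq> POL_ss_closure d m (G_ss d r m)"
      by (rule less.hyps)
    then have "POL_ss_closure d m (graded_wsums d m r ?a) \<subseteq> POL_ss_closure d m (G_ss d r m)"
      by (rule POL_ss_closure_minimal)
    moreover have "\<forall>h<r. a h \<le> d"
      using less.prems by auto
    ultimately show ?thesis
      using graded_wsums_shift[of i r a d m] i by blast
  next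
    case False
    then have eq: "a i = d div 2" if "i < r" for i
      using less.prems that by (meson le_neq_implies_less)
    have "graded_wsums d m r a \<subseteq> G_ss d r m"
      unfolding graded_wsums_def G_ss_eq_wsum using eq by fastforce
    then show ?thesis
      using subset_POL_ss_closure[OF G_ss_subset_POL_ss] by blast
  qed
qed

lemma POL_ss_rank_subset_closure_G_ss:
  "POL_ss_rank d (2 * r) m \<subseteq> POL_ss_closure d m (G_ss d r m)"
proof
  fix P assume P: "P \<in> POL_ss_rank d (2 * r) m"
  then have PM: "P \<in> POL_ss d m" by (simp add: POL_ss_rank_def)
  let ?F = "entries m P"
  have "\<not> pivotable (Suc r) ?F" using P POL_ss_rank_iff[OF PM] by blast
  from not_pivotable_imp_wsum[OF alternating_entries[OF PM] this] obtain q u0 v0 where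
    "q \<noteq> 0" "\<And>j k. q * ?F j k = wsum {..<r} u0 v0 j k" by blast
  from wsum_cancel_factor[OF _ this] obtain u1 v1 where w1: "\<And>j k. ?F j k = wsum {..<r} u1 v1 j k"
    by blast
  \<comment> \<open>Cutting the vectors off at \<open>m\<close> leaves finitely many coordinates, so
    each vector has a uniform degree bound; a sum of degrees serves as a crude one.\<close>
  define u2 v2 where "u2 = (\<lambda>i j. if j < m then u1 i j else 0)" and "v2 = (\<lambda>i j. if j < m then v1 i j else 0)"
  have w2: "wsum {..<r} u2 v2 j k = ?F j k" for j k
  proof (cases "j < m \<and> k < m")
    case True
    then show ?thesis unfolding w1 by (simp add: wsum_def u2_def v2_def)
  next
    case False
    then show ?thesis by (auto simp: entries_def wsum_def u2_def v2_def)
  qed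
  have deg2: "degree (u2 i j) \<le> (\<Sum>l<m. degree (u1 i l))" "degree (v2 i j) \<le> (\<Sum>l<m. degree (v1 i l))" for i j
    by (auto simp: u2_def v2_def intro!: member_le_sum)
  have "\<exists>u v a. wsum {..<r} u v = wsum {..<r} u2 v2 \<and>
    (\<forall>i\<in>{..<r}. a i \<le> d \<and> (\<forall>l. degree (u i l) \<le> a i \<and> degree (v i l) \<le> d - a i))"
    by (rule wsum_reduce_degrees[where a = "\<lambda>i. \<Sum>l<m. degree (u1 i l)" and b = "\<lambda>i. \<Sum>l<m. degree (v1 i l)"])
      (use deg2 POL_ss_degree[OF PM] in \<open>simp_all add: w2\<close>)
  then obtain u3 v3 a where w3: "wsum {..<r} u3 v3 = wsum {..<r} u2 v2"
    and deg3: "\<And>i l. i < r \<Longrightarrow> a i \<le> d \<and> degree (u3 i l) \<le> a i \<and> degree (v3 i l) \<le> d - a i" by blast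
  \<comment> \<open>Pairs are rotated where necessary so that the first vector has the smaller
    bound, at most \<open>d div 2\<close>.\<close>
  define u v a' where "u = (\<lambda>i. if a i \<le> d div 2 then u3 i else v3 i)"
    and "v = (\<lambda>i. if a i \<le> d div 2 then v3 i else (\<lambda>l. - u3 i l))"
    and "a' = (\<lambda>i. if a i \<le> d div 2 then a i else d - a i)"
  have w: "wsum {..<r} u v j k = ?F j k" for j k
  proof -
    have "wsum {..<r} u v j k = wsum {..<r} u3 v3 j k"
      unfolding wsum_def by (rule sum.cong) (auto simp: u_def v_def)
    then show ?thesis by (simp add: w3 w2)
  qed
  have "\<forall>i<r. \<forall>j. degree (u i j) \<le> a' i \<and> degree (v i j) \<le> d - a' i"
    using deg3 by (auto simp: u_def v_def a'_def)
  moreover have "P = mat m m (\<lambda>(j, k). wsum {..<r} u v j k)"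
    by (simp add: w POL_ss_mat_entries[OF PM])
  ultimately have "P \<in> graded_wsums d m r a'"
    unfolding graded_wsums_def by blast
  moreover have "\<forall>i<r. a' i \<le> d div 2" by (auto simp: a'_def)
  ultimately show "P \<in> POL_ss_closure d m (G_ss d r m)"
    using graded_wsums_subset_closure_G_ss by blast
qed

section \<open>Attaining the degree bounds by perturbation\<close>

lemma A_set_subset_G_ss: "A_set d m (replicate r (d - d div 2)) \<subseteq> G_ss d r m"
  unfolding A_set_eq_wsum G_ss_eq_wsum by blast

text \<open>Adding a small multiple of the top monomial to coordinate \<open>0\<close> of every
  vector makes all degree bounds attained; \<open>m > 0\<close> provides this coordinate.\<close>

lemma G_ss_subset_closure_A_set:
  assumes m: "m > 0"
  shows "G_ss d r m \<subseteq> POL_ss_closure d m (A_set d m (replicate r (d - d div 2)))"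
proof
  fix P assume PG: "P \<in> G_ss d r m"
  then obtain u v where P: "P = mat m m (\<lambda>(j, k). wsum {..<r} u v j k)"
    and uv: "\<forall>i<r. \<forall>j<m. degree (u i j) \<le> d div 2 \<and> degree (v i j) \<le> d - d div 2"
    unfolding G_ss_eq_wsum by blast
  define X Y :: "nat \<Rightarrow> complex poly" where "X = (\<lambda>j. if j = 0 then monom 1 (d div 2) else 0)"
    and "Y = (\<lambda>j. if j = 0 then monom 1 (d - d div 2) else 0)"
  \<comment> \<open>There is no quadratic term in the perturbation: \<open>X\<close> and
    \<open>Y\<close> live in the same coordinate, so their wedge product is zero.\<close>
  define R where "R = (\<lambda>j k. \<Sum>i<r. (X j * v i k - v i j * X k) + (u i j * Y k - Y j * u i k))"
  show "P \<in> POL_ss_closure d m (A_set d m (replicate r (d - d div 2)))"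
  proof (rule in_POL_ss_closureI[where R = R])
    show "P \<in> POL_ss d m" using PG G_ss_subset_POL_ss by blast
    fix \<delta> :: real assume "\<delta> > 0"
    \<comment> \<open>Outside these finitely many values the real part of each perturbed top
      coefficient is nonzero.\<close>
    define Z where "Z = (\<lambda>i. - Re (coeff (u i 0) (d div 2))) ` {..<r} \<union>
      (\<lambda>i. - Re (coeff (v i 0) (d - d div 2))) ` {..<r}"
    have "infinite ({0<..<\<delta>} - Z)"
      using \<open>\<delta> > 0\<close> by (intro Diff_infinite_finite) (auto simp: Z_def infinite_Ioo)
    then obtain \<epsilon> where "\<epsilon> \<in> {0<..<\<delta>} - Z"
      using infinite_imp_nonempty by blast
    then have \<epsilon>: "0 < \<epsilon>" "\<epsilon> < \<delta>" "\<epsilon> \<notin> Z" by auto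
    define e where "e = complex_of_real \<epsilon>"
    define u' v' where "u' = (\<lambda>i j. u i j + smult e (X j))" and "v' = (\<lambda>i j. v i j + smult e (Y j))"
    have XY: "X j * Y k = Y j * X k" for j k by (simp add: X_def Y_def mult.commute)
    have eq: "wsum {..<r} u' v' j k = wsum {..<r} u v j k + smult e (R j k)" for j k
    proof -
      have "u' i j * v' i k - v' i j * u' i k = (u i j * v i k - v i j * u i k) +
          [:e:] * ((X j * v i k - v i j * X k) + (u i j * Y k - Y j * u i k))" for i
        using XY[of j k] by (simp add: u'_def v'_def algebra_simps smult_add_right smult_diff_right)
      then have "wsum {..<r} u' v' j k = wsum {..<r} u v j k + [:e:] * R j k"
        unfolding wsum_def R_def sum_distrib_left sum.distrib[symmetric] by (intro sum.cong) simp_all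
      then show ?thesis by simp
    qed
    have nz: "coeff (u' i 0) (d div 2) \<noteq> 0" "coeff (v' i 0) (d - d div 2) \<noteq> 0" if "i < r" for i
    proof -
      have "Re (coeff (u i 0) (d div 2)) + \<epsilon> \<noteq> 0" "Re (coeff (v i 0) (d - d div 2)) + \<epsilon> \<noteq> 0"
        using \<epsilon>(3) that unfolding Z_def by (auto simp: eq_neg_iff_add_eq_0 add.commute)
      then have "Re (coeff (u' i 0) (d div 2)) \<noteq> 0" "Re (coeff (v' i 0) (d - d div 2)) \<noteq> 0"
        by (simp_all add: u'_def v'_def X_def Y_def e_def)
      then show "coeff (u' i 0) (d div 2) \<noteq> 0" "coeff (v' i 0) (d - d div 2) \<noteq> 0" by auto
    qed
    have "degree (X j) \<le> d div 2" "degree (Y j) \<le> d - d div 2" for j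
      by (simp_all add: X_def Y_def degree_monom_le)
    then have deg: "degree (u' i j) \<le> d div 2 \<and> degree (v' i j) \<le> d - d div 2" if "i < r" "j < m" for i j
      using uv that unfolding u'_def v'_def
      by (intro conjI degree_add_le order.trans[OF degree_smult_le]) auto
    let ?Q = "mat m m (\<lambda>(j, k). P $$ (j, k) + smult (complex_of_real \<epsilon>) (R j k))"
    have "?Q = mat m m (\<lambda>(j, k). wsum {..<r} u' v' j k)"
      by (rule eq_matI) (auto simp: P eq e_def)
    then have "?Q \<in> A_set d m (replicate r (d - d div 2))"
      unfolding A_set_eq_wsum using nz deg m by blast
    with \<epsilon>(1,2) show "\<exists>\<epsilon>. 0 < \<epsilon> \<and> \<epsilon> < \<delta> \<and> mat m m (\<lambda>(j, k). P $$ (j, k) + smult (complex_of_real \<epsilon>) (R j k))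
        \<in> A_set d m (replicate r (d - d div 2)) \<inter> POL_ss d m"
      using A_set_subset_G_ss G_ss_subset_POL_ss by blast
  qed
qed

theorem theorem3p8:
  fixes m r d :: nat
  assumes "d \<ge> 1" and "2 \<le> 2 * r" and "2 * r \<le> m - 1"
  shows "POL_ss_closure d m (A_set d m (replicate r (nat \<lceil>real d / 2\<rceil>)))
           = POL_ss_closure d m (G_ss d r m)
       \<and> POL_ss_closure d m (G_ss d r m) = POL_ss_rank d (2 * r) m"
proof
  have "m > 0" using assms(2,3) by linarith
  then have "POL_ss_closure d m (G_ss d r m) \<subseteq> POL_ss_closure d m (A_set d m (replicate r (d - d div 2)))"
    by (intro POL_ss_closure_minimal G_ss_subset_closure_A_set)
  then show "POL_ss_closure d m (A_set d m (replicate r (nat \<lceil>real d / 2\<rceil>))) = POL_ss_closure d m (G_ss d r m)"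
    unfolding nat_ceiling_half using POL_ss_closure_mono[OF A_set_subset_G_ss] by blast
  show "POL_ss_closure d m (G_ss d r m) = POL_ss_rank d (2 * r) m"
    using POL_ss_closure_mono[OF G_ss_subset_POL_ss_rank] POL_ss_closure_rank
      POL_ss_rank_subset_closure_G_ss by blast
qed

end
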